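(* Let $p$ be a prime number, $n\in\mathbb{Z}^+$ and $\gamma\in\mathbb{Z}$ such that $|\gamma|<n$. Suppose that there exists an almost $p$-ary nearly perfect sequence of type $\gamma$ and period $n+1$. Then the following hold. (i) Suppose $\gamma=0$. Let $q\ne p$ be a prime number dividing $n$ such that $q^r\,\|\,n$ and $q$ is self-conjugate modulo $up$ for some divisor $u\ge 1$ of $n+1$. Then $r$ is even and $q^{r/2}\le\frac{n+1}{u}$. (ii) Suppose $\gamma=-1$. Let $q\ne p$ be a prime number dividing $n-\gamma$ such that $q^r\,\|\,n-\gamma$ and $q$ is self-conjugate modulo $up$ for some divisor $u>1$ of $n+1$. If $q\nmid u$, then $r$ is even and $q^{r/2}\le\frac{n+1}{u}$. If $q\mid u$, then $q^{\lfloor r/2\rfloor}\le 2\frac{n+1}{u}$. (iii) Suppose $\gamma\ne 0$. Let $q\ne p$ be a prime number such that one of the following holds: (a) $q$ divides $(\gamma+1)n$, $q^r\,\|\,(\gamma+1)n$, and $q$ is self-conjugate modulo $up$ for some divisor $u\ge 1$ of $n+1$; or (b) $q$ divides $n-\gamma$, $q^r\,\|\,n-\gamma$, and $q$ is self-conjugate modulo $up$ for some divisor $u>1$ of $n+1$. If $q\nmid u$, then $r$ is even.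
   Context: An almost $p$-ary sequence of period $N$ is a sequence $\underline{a}=(a_0,a_1,\ldots)$ of complex numbers of period $N$ (so $a_{i+N}=a_i$) with $a_0=0$ and with $a_1,\ldots,a_{N-1}$ all powers of a primitive $p$-th root of unity $\zeta_p\in\mathbb{C}$. Its autocorrelation function is $C_{\underline{a}}(t)=\sum_{i=0}^{N-1}a_i\overline{a_{i+t}}$ for $0\le t\le N-1$. The sequence is a nearly perfect sequence (NPS) of type $\gamma$ if $C_{\underline{a}}(t)=\gamma$ for all $1\le t\le N-1$. For a prime $q$ and an integer $v\ge 1$ written as $v=q^e w$ with $\gcd(q,w)=1$, $q$ is called self-conjugate modulo $v$ if $q^j\equiv -1\pmod w$ for some integer $j$. The notation $q^r\,\|\,M$ means $q^r\mid M$ and $q^{r+1}\nmid M$. *)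

theory Defs
  imports Complex_Main "HOL-Computational_Algebra.Primes" "HOL-Number_Theory.Cong"
begin

definition primitive_root_of_unity :: "nat \<Rightarrow> complex \<Rightarrow> bool" where
  "primitive_root_of_unity m z \<longleftrightarrow> z ^ m = 1 \<and> (\<forall>k. 0 < k \<and> k < m \<longrightarrow> z ^ k \<noteq> 1)"

definition almost_p_ary :: "nat \<Rightarrow> nat \<Rightarrow> (nat \<Rightarrow> complex) \<Rightarrow> bool" where
  "almost_p_ary p N a \<longleftrightarrow>
     (\<forall>i. a (i + N) = a i) \<and> a 0 = 0 \<and>
     (\<exists>\<zeta>. primitive_root_of_unity p \<zeta> \<and> (\<forall>i\<in>{1..<N}. \<exists>k. a i = \<zeta> ^ k))"

definition autocorrelation :: "nat \<Rightarrow> (nat \<Rightarrow> complex) \<Rightarrow> nat \<Rightarrow> complex" where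
  "autocorrelation N a t = (\<Sum>i<N. a i * cnj (a (i + t)))"

definition nearly_perfect :: "nat \<Rightarrow> (nat \<Rightarrow> complex) \<Rightarrow> int \<Rightarrow> bool" where
  "nearly_perfect N a \<gamma> \<longleftrightarrow> (\<forall>t\<in>{1..<N}. autocorrelation N a t = of_int \<gamma>)"

(* Restricting the exponent j to nonnegative integers loses nothing: q is a unit modulo w
   and the inverse of -1 is -1. *)
definition self_conjugate :: "nat \<Rightarrow> nat \<Rightarrow> bool" where
  "self_conjugate q v \<longleftrightarrow>
     (\<exists>e w. v = q ^ e * w \<and> coprime q w \<and> (\<exists>j::nat. [int q ^ j = - 1] (mod int w)))"

definition exactly_divides :: "nat \<Rightarrow> nat \<Rightarrow> int \<Rightarrow> bool" where
  "exactly_divides q r M \<longleftrightarrow> int q ^ r dvd M \<and> \<not> int q ^ (r + 1) dvd M"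

end

theory Submission
  imports Defs "HOL-Computational_Algebra.Polynomial"
begin

text \<open>
  Write \<open>N = n + 1\<close> and let \<open>A(X) = \<Sum> a\<^sub>i X\<^sup>i\<close> be the polynomial of the sequence.  The correlation
  condition says that \<open>|A(x)|\<^sup>2 = n - \<gamma>\<close> at every \<open>N\<close>-th root of unity \<open>x \<noteq> 1\<close>, and that
  \<open>|A(1)|\<^sup>2 = (\<gamma> + 1) n\<close> (lemma \<open>norm_character\<close>).  If \<open>x\<^sup>u = 1\<close>, then \<open>A(x)\<close> lies in the ring
  generated by \<open>\<zeta>\<^sub>p\<close> and \<open>x\<close>, where self-conjugacy of \<open>q\<close> modulo \<open>up\<close> restricts how \<open>q\<close> can divide a norm.

  The restriction needs no factorisation into prime ideals.  Let \<open>Q = q\<^sup>j\<close> with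
  \<open>Q \<equiv> -1\<close> modulo the part of \<open>up\<close> prime to \<open>q\<close>.  Then \<open>f\<^sup>Q\<close> is congruent to the complex
  conjugate of \<open>f\<close> modulo \<open>\<pi>\<close>, where \<open>\<pi> = q\<close> if \<open>q\<close> does not divide \<open>u\<close>, and \<open>\<pi> = 1 - x\<^sup>w\<close> if
  \<open>u = q\<^sup>e w\<close> with \<open>e \<ge> 1\<close> and \<open>x\<^sup>w\<close> of exact order \<open>q\<^sup>e\<close>.  Applying this twice shows that \<open>\<pi>\<close> divides \<open>f\<close> as soon
  as it divides \<open>f\<close> times its conjugate; repeating the argument after division by \<open>\<pi>\<close>,
  \<open>\<pi>\<^sup>t\<close> dividing the norm forces \<open>\<pi>\<close> to the power \<open>\<lceil>t/2\<rceil>\<close> to divide \<open>f\<close>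
  (lemma \<open>power_dvd_of_power_dvd_norm\<close>).  In the first case \<open>q\<close> to the power
  \<open>\<lceil>r/2\<rceil>\<close> divides \<open>f\<close>; in the second \<open>\<pi>\<close> to the power \<open>q\<^sup>e\<^sup>-\<^sup>1(q - 1)\<close> is \<open>q\<close> times a unit, and
  \<open>q\<close> to the power \<open>\<lfloor>r/2\<rfloor>\<close> divides \<open>f\<close>.

  Parity follows at a single root \<open>x\<close>: if \<open>r\<close> were odd, \<open>q\<^sup>r\<^sup>+\<^sup>1\<close> would divide the integer \<open>|A(x)|\<^sup>2\<close>
  in a ring of cyclotomic integers, hence in the integers (lemma \<open>int_dvd_of_ev2\<close>, a
  Nakayama argument).

  For the bounds the divisibility is proved for functions on a set of roots, not at one root:
  \<open>A(x) = q\<^sup>s F(x)\<close> with one and the same polynomial \<open>F\<close> for all \<open>x\<close> with \<open>x\<^sup>u = 1\<close>.  Comparing coefficients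
  modulo \<open>X\<^sup>u - 1\<close> makes each sum of the \<open>a\<^sub>i\<close> over a residue class modulo \<open>u\<close> divisible by \<open>q\<^sup>s\<close>
  in the ring generated by \<open>\<zeta>\<^sub>p\<close>.  The only integral relations among the powers of
  \<open>\<zeta>\<^sub>p\<close> are the multiples of \<open>1 + \<zeta>\<^sub>p + ... + \<zeta>\<^sub>p\<^sup>p\<^sup>-\<^sup>1 = 0\<close>, so the numbers of occurrences of the different powers of
  \<open>\<zeta>\<^sub>p\<close> in the class are congruent modulo \<open>q\<^sup>s\<close>.  For some class they are not all equal,
  because \<open>A\<close> does not vanish at all \<open>u\<close>-th roots of unity, and they lie between \<open>0\<close> and \<open>N/u\<close>; hence \<open>q\<^sup>s \<le> N/u\<close>.
  If \<open>q\<close> divides \<open>u\<close>, the divisibility is available only where \<open>x\<close> is not a root of unity of order dividing \<open>u/q\<close>;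
  multiplying by \<open>1 - X\<^sup>k\<close> with \<open>k = u/q\<close> removes the other roots, and the differences of
  counts that arise lie between \<open>-N/u\<close> and \<open>N/u\<close>, which costs the factor \<open>2\<close>.
\<close>

section \<open>Evaluation of polynomials through a coefficient homomorphism\<close>

definition eval_via :: "('a::zero \<Rightarrow> 'b::comm_ring_1) \<Rightarrow> 'a poly \<Rightarrow> 'b \<Rightarrow> 'b" where
  "eval_via h P x = poly (map_poly h P) x"

locale coeff_hom =
  fixes h :: "'a::comm_ring_1 \<Rightarrow> 'b::comm_ring_1"
  assumes h0 [simp]: "h 0 = 0" and h1 [simp]: "h 1 = 1"
    and h_add: "h (a + b) = h a + h b" and h_mult: "h (a * b) = h a * h b"
begin

lemma eval_0 [simp]: "eval_via h 0 x = 0"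
  by (simp add: eval_via_def)

lemma eval_pCons [simp]: "eval_via h (pCons c P) x = h c + x * eval_via h P x"
  by (simp add: eval_via_def map_poly_pCons)

lemma eval_1 [simp]: "eval_via h 1 x = 1"
  by (simp add: one_pCons)

lemma eval_add: "eval_via h (P + Q) x = eval_via h P x + eval_via h Q x"
  by (induction P Q rule: poly_induct2) (simp_all add: h_add algebra_simps)

lemma eval_smult: "eval_via h (smult c P) x = h c * eval_via h P x"
  by (induction P) (simp_all add: h_mult algebra_simps)

lemma eval_mult: "eval_via h (P * Q) x = eval_via h P x * eval_via h Q x"
  by (induction P) (simp_all add: eval_add eval_smult algebra_simps)

lemma eval_power: "eval_via h (P ^ n) x = eval_via h P x ^ n"
  by (induction n) (simp_all add: eval_mult)

lemma eval_minus: "eval_via h (- P) x = - eval_via h P x"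
  using eval_add[of P "- P" x] by (simp add: add_eq_0_iff)

lemma eval_diff: "eval_via h (P - Q) x = eval_via h P x - eval_via h Q x"
  using eval_add[of P "- Q" x] by (simp add: eval_minus)

lemma eval_of_nat: "eval_via h (of_nat n) x = of_nat n"
  by (induction n) (simp_all add: eval_add)

lemma eval_of_int: "eval_via h (of_int n) x = of_int n"
  by (cases n) (simp_all add: eval_of_nat eval_minus eval_diff)

lemma eval_sum: "eval_via h (\<Sum>i\<in>I. P i) x = (\<Sum>i\<in>I. eval_via h (P i) x)"
  by (induction I rule: infinite_finite_induct) (simp_all add: eval_add)

lemma eval_monom: "eval_via h (monom c n) x = h c * x ^ n"
  by (simp add: eval_via_def map_poly_monom poly_monom)

lemmas eval_simps = eval_add eval_mult eval_smult eval_power eval_minus eval_diff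
  eval_of_nat eval_of_int eval_sum eval_monom

lemma eval_pcompose:
  "eval_via h (pcompose P Q) x = eval_via h P (eval_via h Q x)"
  by (induction P) (simp_all add: pcompose_pCons eval_simps)

lemma eval_coeffs: "eval_via h P x = (\<Sum>i\<le>degree P. h (coeff P i) * x ^ i)"
proof -
  have "eval_via h P x = eval_via h (\<Sum>i\<le>degree P. monom (coeff P i) i) x"
    by (simp add: poly_as_sum_of_monoms)
  then show ?thesis by (simp add: eval_simps)
qed

lemma hom_via: "coeff_hom (\<lambda>P. eval_via h P x)"
  by unfold_locales (simp_all add: eval_simps)

lemma h_sum: "h (\<Sum>i\<in>I. f i) = (\<Sum>i\<in>I. h (f i))"
  by (induction I rule: infinite_finite_induct) (simp_all add: h_add)

end

text \<open>
  Elements of the ring generated by two roots of unity \<open>\<zeta>\<close> and \<open>x\<close> are values of integer polynomials in two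
  variables.  The inner variable is evaluated at the fixed \<open>\<zeta>\<close>, the outer one at \<open>x\<close>, which varies:
  congruences between the polynomials then hold uniformly in \<open>x\<close>.
\<close>

definition ev1 :: "int poly \<Rightarrow> complex \<Rightarrow> complex" where
  "ev1 = eval_via of_int"

definition ev2 :: "complex \<Rightarrow> int poly poly \<Rightarrow> complex \<Rightarrow> complex" where
  "ev2 \<zeta> = eval_via (\<lambda>c. ev1 c \<zeta>)"

interpretation int_hom: coeff_hom "of_int :: int \<Rightarrow> complex"
  rewrites "eval_via of_int = ev1"
  by unfold_locales (simp_all add: ev1_def)

interpretation ev1_hom: coeff_hom "\<lambda>c. ev1 c \<zeta>"
  rewrites "eval_via (\<lambda>c. ev1 c \<zeta>) = ev2 \<zeta>"
  by (rule int_hom.hom_via) (simp add: ev2_def)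

lemmas ev1_simps = int_hom.eval_simps
lemmas ev2_simps = ev1_hom.eval_simps

lemmas ev1_pcompose = int_hom.eval_pcompose

section \<open>Reduction of exponents modulo the order of a root of unity\<close>

text \<open>The coefficient of \<open>X\<^sup>j\<close> in the remainder of \<open>P\<close> modulo \<open>X\<^sup>m - 1\<close>, for \<open>j < m\<close>.\<close>

definition fold_coeff :: "nat \<Rightarrow> 'a::comm_monoid_add poly \<Rightarrow> nat \<Rightarrow> 'a" where
  "fold_coeff m P j = (\<Sum>i | i \<le> degree P \<and> i mod m = j. coeff P i)"

lemma fold_coeff_bound:
  assumes "degree P \<le> n"
  shows "fold_coeff m P j = (\<Sum>i | i \<le> n \<and> i mod m = j. coeff P i)"
  unfolding fold_coeff_def
  by (rule sum.mono_neutral_left) (use assms in \<open>auto intro: le_degree\<close>)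

lemma fold_coeff_add:
  "fold_coeff m (P + Q) j = fold_coeff m P j + fold_coeff m Q j"
proof -
  define n where "n = max (degree P) (degree Q)"
  have "degree P \<le> n" "degree Q \<le> n" "degree (P + Q) \<le> n"
    by (auto simp: n_def degree_add_le_max)
  then show ?thesis by (simp add: fold_coeff_bound sum.distrib)
qed

lemma fold_coeff_0 [simp]: "fold_coeff m 0 j = 0"
  by (simp add: fold_coeff_def)

lemma fold_coeff_diff:
  fixes P Q :: "'a::ab_group_add poly"
  shows "fold_coeff m (P - Q) j = fold_coeff m P j - fold_coeff m Q j"
  using fold_coeff_add[of m "P - Q" Q j] by (simp add: algebra_simps)

lemma fold_coeff_smult:
  fixes P :: "'a::comm_semiring_0 poly"
  shows "fold_coeff m (smult c P) j = c * fold_coeff m P j"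
proof -
  have "degree (smult c P) \<le> degree P" by (rule degree_smult_le)
  then show ?thesis
    by (simp add: fold_coeff_bound[of _ "degree P"] sum_distrib_left)
qed

lemma fold_coeff_sum:
  "fold_coeff m (\<Sum>i\<in>I. P i) j = (\<Sum>i\<in>I. fold_coeff m (P i) j)"
  by (induction I rule: infinite_finite_induct) (simp_all add: fold_coeff_add)

lemma fold_coeff_monom:
  "fold_coeff m (monom c n) j = (if n mod m = j then c else 0)"
proof -
  have "fold_coeff m (monom c n) j = (\<Sum>i | i \<le> n \<and> i mod m = j. coeff (monom c n) i)"
    by (rule fold_coeff_bound) (rule degree_monom_le)
  also have "\<dots> = (\<Sum>i | i \<le> n \<and> i mod m = j. if i = n then c else 0)"
    by (rule sum.cong) auto
  also have "\<dots> = (if n mod m = j then c else 0)"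
    by (simp add: sum.delta)
  finally show ?thesis .
qed

lemma (in coeff_hom) eval_fold:
  assumes "x ^ m = 1" "m > 0"
  shows "eval_via h P x = (\<Sum>j<m. h (fold_coeff m P j) * x ^ j)"
proof -
  have pow: "x ^ i = x ^ (i mod m)" for i
  proof -
    have "x ^ i = x ^ (m * (i div m) + i mod m)" by simp
    also have "\<dots> = x ^ (i mod m)"
      unfolding power_add power_mult using assms by simp
    finally show ?thesis .
  qed
  have "eval_via h P x = (\<Sum>i\<le>degree P. h (coeff P i) * x ^ (i mod m))"
    unfolding eval_coeffs by (rule sum.cong) (use pow in auto)
  also have "\<dots> = (\<Sum>j<m. \<Sum>i | i \<in> {..degree P} \<and> i mod m = j. h (coeff P i) * x ^ (i mod m))"
    by (rule sum.group[symmetric]) (use assms in auto)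
  also have "\<dots> = (\<Sum>j<m. h (fold_coeff m P j) * x ^ j)"
    by (rule sum.cong) (auto simp: fold_coeff_def h_sum sum_distrib_right)
  finally show ?thesis .
qed

lemma vanishing_on_roots_of_unity:
  fixes g :: "nat \<Rightarrow> complex"
  assumes "u > 0" and van: "\<And>x. x ^ u = 1 \<Longrightarrow> (\<Sum>j<u. g j * x ^ j) = 0" and "j < u"
  shows "g j = 0"
proof -
  define P where "P = (\<Sum>j<u. monom (g j) j)"
  have poly: "poly P x = (\<Sum>j<u. g j * x ^ j)" for x
    by (simp add: P_def poly_sum poly_monom)
  have cf: "coeff P i = (if i < u then g i else 0)" for i
    by (simp add: P_def coeff_sum sum.delta')
  have "P = 0"
  proof (rule ccontr)
    assume "P \<noteq> 0"
    have "degree P \<le> u - 1"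
      by (rule degree_le) (use cf in auto)
    have "u = card {x::complex. x ^ u = 1}"
      using card_roots_unity_eq assms(1) by simp
    also have "\<dots> \<le> card {x. poly P x = 0}"
      by (rule card_mono) (use van poly poly_roots_finite[OF \<open>P \<noteq> 0\<close>] in auto)
    also have "\<dots> \<le> degree P"
      by (rule card_poly_roots_bound) fact
    finally show False using \<open>degree P \<le> u - 1\<close> assms(1) by simp
  qed
  then show ?thesis using cf[of j] \<open>j < u\<close> by simp
qed

lemma sum_powers_root_of_unity:
  fixes x :: complex
  assumes "x ^ m = 1" "x \<noteq> 1"
  shows "(\<Sum>i<m. x ^ i) = 0"
  using one_diff_power_eq[of x m] assms by simp

lemma ex_root_of_unity_not_root:
  assumes "0 < s" "s < u"
  shows "\<exists>x::complex. x ^ u = 1 \<and> x ^ s \<noteq> 1"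
proof (rule ccontr)
  assume "\<not> ?thesis"
  then have "{x::complex. x ^ u = 1} \<subseteq> {x. x ^ s = 1}" by auto
  moreover have "finite {x::complex. x ^ s = 1}"
    using card_roots_unity_eq[OF assms(1)] assms(1) by (metis card.infinite less_irrefl)
  ultimately have "card {x::complex. x ^ u = 1} \<le> card {x::complex. x ^ s = 1}"
    by (rule card_mono[rotated])
  then show False using card_roots_unity_eq[of u] card_roots_unity_eq[of s] assms by simp
qed

section \<open>Divisibility of integers in cyclotomic rings\<close>

text \<open>
  Nakayama's lemma for the prime \<open>q\<close>, by elimination of one generator at a time: solving the
  equation of \<open>v a\<close> for \<open>v a\<close> only divides by \<open>s - q * M a a\<close>, which is again prime to \<open>q\<close>.
  The factor \<open>s\<close> collects these denominators.
\<close>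

lemma nakayama:
  fixes v :: "'i \<Rightarrow> complex" and M :: "'i \<Rightarrow> 'i \<Rightarrow> int" and s :: int
  assumes "finite I" "prime q" "\<not> q dvd s"
    and "\<And>i. i \<in> I \<Longrightarrow> of_int s * v i = of_int q * (\<Sum>k\<in>I. of_int (M i k) * v k)"
    and "i \<in> I"
  shows "v i = 0"
  using assms(1,3-5)
proof (induction I arbitrary: s M i rule: finite_induct)
  case empty
  then show ?case by simp
next
  case (insert a I)
  define s' where "s' = s - q * M a a"
  have s': "\<not> q dvd s'"
    using insert.prems(1) by (simp add: s'_def dvd_diff_left_iff)
  have s0: "of_int s' \<noteq> (0::complex)" using s' by auto
  have va: "of_int s' * v a = of_int q * (\<Sum>k\<in>I. of_int (M a k) * v k)"
    using insert.prems(2)[of a] insert.hyps by (simp add: s'_def algebra_simps)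
  have zero: "v i = 0" if i: "i \<in> I" for i
  proof (rule insert.IH)
    show "\<not> q dvd s * s'"
      using insert.prems(1) s' \<open>prime q\<close> by (simp add: prime_dvd_mult_iff)
    fix i assume i: "i \<in> I"
    let ?M = "\<lambda>i k. s' * M i k + q * M i a * M a k"
    have "of_int (s * s') * v i
        = of_int s' * (of_int q * (of_int (M i a) * v a + (\<Sum>k\<in>I. of_int (M i k) * v k)))"
      using insert.prems(2)[of i] insert.hyps i by (simp add: algebra_simps)
    also have "\<dots> = of_int q * (of_int (M i a) * (of_int s' * v a)
        + of_int s' * (\<Sum>k\<in>I. of_int (M i k) * v k))"
      by (simp add: algebra_simps)
    also have "\<dots> = of_int q * (\<Sum>k\<in>I. of_int (?M i k) * v k)"
      unfolding va by (simp add: sum_distrib_left sum.distrib algebra_simps)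
    finally show "of_int (s * s') * v i = of_int q * (\<Sum>k\<in>I. of_int (?M i k) * v k)" .
  qed (rule i)
  then have "of_int s' * v a = 0" unfolding va by simp
  then have "v a = 0" using s0 by simp
  with zero insert.prems(3) show ?case by blast
qed

lemma ev2_fold2:
  assumes "\<zeta> ^ p = 1" "p > 0" "x ^ u = 1" "u > 0"
  shows "ev2 \<zeta> G x = (\<Sum>(j,k)\<in>{..<u} \<times> {..<p}.
           of_int (fold_coeff p (fold_coeff u G j) k) * (x ^ j * \<zeta> ^ k))"
  unfolding ev1_hom.eval_fold[OF assms(3,4)] int_hom.eval_fold[OF assms(1,2)]
  by (simp add: sum.cartesian_product[symmetric] sum_distrib_left algebra_simps)

text \<open>
  If \<open>s\<close> is \<open>q\<close> times an element of the ring, then \<open>s\<close> maps the finitely generated group spanned by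
  the \<open>x\<^sup>j \<zeta>\<^sup>k\<close> into \<open>q\<close> times itself.  For \<open>s\<close> prime to \<open>q\<close> this would make the group trivial.
\<close>

lemma int_dvd_of_ev2:
  assumes z: "\<zeta> ^ p = 1" "p > 0" "x ^ u = 1" "u > 0" and q: "prime (q::int)"
    and eq: "of_int s = of_int q * ev2 \<zeta> G x"
  shows "q dvd s"
proof (rule ccontr)
  assume nd: "\<not> q dvd s"
  let ?I = "{..<u} \<times> {..<p}" and ?v = "\<lambda>(j,k). x ^ j * \<zeta> ^ k"
  let ?G = "\<lambda>(j,k). G * monom (monom 1 k) j"
  let ?M = "\<lambda>i (j,k). fold_coeff p (fold_coeff u (?G i) j) k"
  have "?v (0,0) = 0"
  proof (rule nakayama[where I = ?I and M = ?M])
    fix i assume "i \<in> ?I"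
    have "of_int s * ?v i = of_int q * ev2 \<zeta> (?G i) x"
      by (cases i) (simp add: eq ev2_simps ev1_simps algebra_simps)
    also have "\<dots> = of_int q * (\<Sum>k\<in>?I. of_int (?M i k) * ?v k)"
      unfolding ev2_fold2[OF z] by (simp add: case_prod_unfold)
    finally show "of_int s * ?v i = of_int q * (\<Sum>k\<in>?I. of_int (?M i k) * ?v k)" .
  qed (use z nd q in auto)
  then show False by simp
qed

lemma int_dvd_of_ev1:
  assumes "\<zeta> ^ p = 1" "p > 0" "prime (q::int)" "of_int s = of_int q * ev1 G \<zeta>"
  shows "q dvd s"
  using int_dvd_of_ev2[of \<zeta> p 1 1 q s "[:G:]"] assms by simp

section \<open>Ramification of a prime at roots of unity of prime power order\<close>

lemma dvd_power_diff:
  fixes x y :: "'a::comm_ring_1"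
  assumes "c dvd x - y"
  shows "c dvd x ^ n - y ^ n"
  using assms unfolding power_diff_sumr2 by (rule dvd_mult2)

text \<open>
  The Frobenius map is additive modulo \<open>q\<close>.  It is needed in polynomial rings over the integers,
  which have characteristic 0, hence the formulation by divisibility.
\<close>

lemma prime_dvd_binomial_power:
  fixes a b :: "'a::comm_ring_1"
  assumes q: "prime q"
  shows "of_nat q dvd (a + b) ^ (q ^ k) - (a ^ (q ^ k) + b ^ (q ^ k))"
proof (induction k)
  case 0
  then show ?case by simp
next
  case (Suc k)
  have base: "of_nat q dvd (x + y) ^ q - (x ^ q + y ^ q)" for x y :: 'a
  proof -
    let ?t = "\<lambda>i. of_nat (q choose i) * x ^ i * y ^ (q - i)"
    have "q > 0" using q prime_gt_0_nat by blast
    then have split: "{..q} = insert 0 (insert q {0<..<q})" by auto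
    have "(x + y) ^ q = (\<Sum>i\<le>q. ?t i)" by (rule binomial_ring)
    also have "\<dots> = x ^ q + y ^ q + (\<Sum>i\<in>{0<..<q}. ?t i)"
      unfolding split using \<open>q > 0\<close> by simp
    finally have "(x + y) ^ q - (x ^ q + y ^ q) = (\<Sum>i\<in>{0<..<q}. ?t i)" by simp
    moreover have "of_nat q dvd (\<Sum>i\<in>{0<..<q}. ?t i)"
    proof (rule dvd_sum)
      fix i assume "i \<in> {0<..<q}"
      then have "q dvd (q choose i)" using dvd_choose_prime[of i q] q by auto
      then show "of_nat q dvd ?t i" by (metis of_nat_mult dvd_def dvd_mult2)
    qed
    ultimately show ?thesis by simp
  qed
  have "of_nat q dvd ((a + b) ^ (q ^ k)) ^ q - (a ^ (q ^ k) + b ^ (q ^ k)) ^ q"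
    by (rule dvd_power_diff) (rule Suc.IH)
  from dvd_add[OF this base[of "a ^ (q ^ k)" "b ^ (q ^ k)"]] show ?case
    by (simp add: power_mult[symmetric] mult.commute algebra_simps)
qed

lemma geometric_sum_powers:
  fixes y :: "'a::comm_ring_1"
  shows "(1 - y ^ m) * (\<Sum>i<n. y ^ (m * i)) = 1 - y ^ (m * n)"
  unfolding power_mult by (rule one_diff_power_eq[symmetric])

text \<open>
  The sum is the cyclotomic polynomial of order \<open>q\<^sup>k\<^sup>+\<^sup>1\<close>, that is, the quotient of
  \<open>1 - Y\<close> with \<open>Y\<close> raised to \<open>q\<^sup>k\<^sup>+\<^sup>1\<close> by the same with \<open>q\<^sup>k\<close>.  Modulo \<open>q\<close> numerator and denominator are powers of
  \<open>1 - Y\<close>, and the denominator can be cancelled because \<open>q\<close> is prime in the ring of integer polynomials.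
\<close>

lemma power_cyclotomic_cong:
  fixes Y :: "int poly"
  assumes q: "prime q" and Y: "Y = [:0, 1:]"
  shows "of_nat q dvd (1 - Y) ^ (q ^ k * (q - 1)) - (\<Sum>i<q. Y ^ (q ^ k * i))"
proof -
  let ?m = "q ^ k"
  let ?\<Phi> = "\<Sum>i<q. Y ^ (?m * i)"
  have q1: "q > 1" using q prime_gt_1_nat by blast
  have diff: "of_nat q dvd (1 - Y) ^ (q ^ j) - (1 - Y ^ (q ^ j))" for j
    using prime_dvd_binomial_power[OF q, of "1 - Y" Y j]
    by (subst dvd_minus_iff[symmetric]) (simp add: algebra_simps)
  have e1: "(1 - Y) ^ ?m * (1 - Y) ^ (?m * (q - 1)) = (1 - Y) ^ (q ^ Suc k)"
  proof -
    have "?m + ?m * (q - 1) = q ^ Suc k" using q1 by (cases q) simp_all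
    then show ?thesis by (simp only: power_add[symmetric])
  qed
  have e2: "(1 - Y ^ ?m) * ?\<Phi> = 1 - Y ^ (q ^ Suc k)"
    using geometric_sum_powers[of Y ?m q] by (simp add: mult.commute)
  have "(1 - Y ^ ?m) * ((1 - Y) ^ (?m * (q - 1)) - ?\<Phi>)
      = ((1 - Y) ^ (q ^ Suc k) - (1 - Y ^ (q ^ Suc k)))
        - ((1 - Y) ^ ?m - (1 - Y ^ ?m)) * (1 - Y) ^ (?m * (q - 1))"
    unfolding e1[symmetric] e2[symmetric] by (simp add: algebra_simps)
  also have "of_nat q dvd \<dots>"
    by (intro dvd_diff dvd_mult2 diff)
  finally have "of_nat q dvd (1 - Y ^ ?m) * ((1 - Y) ^ (?m * (q - 1)) - ?\<Phi>)" .
  moreover have "prime_elem (of_nat q :: int poly)"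
    unfolding of_nat_poly using q by (intro lift_prime_elem_poly) simp
  moreover have "\<not> of_nat q dvd 1 - Y ^ ?m"
  proof
    assume "of_nat q dvd 1 - Y ^ ?m"
    then have "int q dvd coeff (1 - Y ^ ?m) 0"
      unfolding of_nat_poly const_poly_dvd_iff by blast
    also have "coeff (1 - Y ^ ?m) 0 = 1"
      using q1 by (simp add: Y coeff_0_power power_0_left)
    finally show False using q1 by simp
  qed
  ultimately show ?thesis by (simp add: prime_elem_dvd_mult_iff)
qed

text \<open>
  For \<open>\<eta>\<close> of exact order \<open>q\<^sup>k\<^sup>+\<^sup>1\<close>, the elements \<open>q\<close> and \<open>(1 - \<eta>)\<^sup>\<phi>\<close> are associated.  The polynomials \<open>A\<close> and \<open>B\<close>
  do not depend on \<open>\<eta>\<close>; this uniformity is what allows \<open>\<eta>\<close> to be replaced by a function later.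

  One divisibility is the previous congruence \<open>(1 - Y)\<^sup>\<phi> = \<Phi> + q H\<close> at a root of \<open>\<Phi>\<close>.  For the
  other, evaluation at \<open>Y = 1\<close> gives \<open>H(1) = -1\<close>, so \<open>q\<close> equals \<open>-(1 - \<eta>)\<^sup>\<phi>\<close> up to a multiple
  of \<open>q (1 - \<eta>)\<close>.  Hence, up to the exponent \<open>\<phi>\<close>, every power of \<open>1 - \<eta>\<close> that divides \<open>q\<close> can be raised by one.
\<close>

lemma totally_ramified:
  assumes q: "prime q" and \<phi>: "\<phi> = q ^ k * (q - 1)"
  shows "\<exists>A B. \<forall>\<eta>. \<eta> ^ (q ^ Suc k) = 1 \<and> \<eta> ^ (q ^ k) \<noteq> 1 \<longrightarrow>
       (1 - \<eta>) ^ \<phi> = of_nat q * ev1 A \<eta> \<and> of_nat q = (1 - \<eta>) ^ \<phi> * ev1 B \<eta>"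
proof -
  define Y :: "int poly" where "Y = [:0, 1:]"
  have q1: "q > 1" using q prime_gt_1_nat by blast
  have evY: "ev1 Y \<eta> = \<eta>" for \<eta> by (simp add: Y_def)
  obtain H where H: "(1 - Y) ^ \<phi> - (\<Sum>i<q. Y ^ (q ^ k * i)) = of_nat q * H"
    using power_cyclotomic_cong[OF q Y_def, of k] \<phi> by (auto elim: dvdE)
  have "\<phi> > 0" using q1 \<phi> by simp
  have "poly (of_nat q * H) 1 = - int q"
    using \<open>\<phi> > 0\<close> unfolding H[symmetric] by (simp add: poly_sum Y_def)
  then have "int q * (poly H 1 + 1) = 0" by (simp add: of_nat_poly algebra_simps)
  then have "poly (H + 1) 1 = 0" using q1 by simp
  then obtain K where K: "H + 1 = [:-1, 1:] * K"
    unfolding poly_eq_0_iff_dvd by (auto elim: dvdE)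
  have unit: "\<exists>C. \<forall>\<eta>. \<eta> ^ (q ^ Suc k) = 1 \<longrightarrow> \<eta> ^ (q ^ k) \<noteq> 1 \<longrightarrow> of_nat q = (1 - \<eta>) ^ i * ev1 C \<eta>"
    and van: "\<And>\<eta>. \<eta> ^ (q ^ Suc k) = 1 \<Longrightarrow> \<eta> ^ (q ^ k) \<noteq> 1 \<Longrightarrow> (1 - \<eta>) ^ \<phi> = of_nat q * ev1 H \<eta>"
    if "i \<le> \<phi>" for i
  proof -
    show van: "(1 - \<eta>) ^ \<phi> = of_nat q * ev1 H \<eta>"
      if \<eta>: "\<eta> ^ (q ^ Suc k) = 1" "\<eta> ^ (q ^ k) \<noteq> 1" for \<eta>
    proof -
      have "(1 - \<eta> ^ (q ^ k)) * (\<Sum>i<q. \<eta> ^ (q ^ k * i)) = 1 - \<eta> ^ (q ^ Suc k)"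
        using geometric_sum_powers[of \<eta> "q ^ k" q] by (simp add: mult.commute)
      then have "(\<Sum>i<q. \<eta> ^ (q ^ k * i)) = 0" using \<eta> by simp
      moreover have "ev1 ((1 - Y) ^ \<phi> - (\<Sum>i<q. Y ^ (q ^ k * i))) \<eta> = of_nat q * ev1 H \<eta>"
        unfolding H by (simp add: ev1_simps)
      ultimately show ?thesis by (simp add: ev1_simps evY)
    qed
    show "\<exists>C. \<forall>\<eta>. \<eta> ^ (q ^ Suc k) = 1 \<longrightarrow> \<eta> ^ (q ^ k) \<noteq> 1 \<longrightarrow> of_nat q = (1 - \<eta>) ^ i * ev1 C \<eta>"
      using that
    proof (induction i)
      case 0
      have "of_nat q = ev1 (of_nat q) \<eta>" for \<eta> by (simp add: ev1_simps)
      then show ?case by (intro exI[of _ "of_nat q"]) simp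
    next
      case (Suc i)
      then obtain C where C: "\<And>\<eta>. \<eta> ^ (q ^ Suc k) = 1 \<Longrightarrow> \<eta> ^ (q ^ k) \<noteq> 1 \<Longrightarrow>
          of_nat q = (1 - \<eta>) ^ i * ev1 C \<eta>" by auto
      have "of_nat q = (1 - \<eta>) ^ Suc i * ev1 (- ((1 - Y) ^ (\<phi> - Suc i)) - C * K) \<eta>"
        if \<eta>: "\<eta> ^ (q ^ Suc k) = 1" "\<eta> ^ (q ^ k) \<noteq> 1" for \<eta>
      proof -
        have "ev1 (H + 1) \<eta> = (\<eta> - 1) * ev1 K \<eta>"
          unfolding K by (simp add: ev1_simps algebra_simps)
        then have "ev1 H \<eta> = (\<eta> - 1) * ev1 K \<eta> - 1"
          by (simp only: ev1_simps int_hom.eval_1 eq_diff_eq)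
        then have "(1 - \<eta>) ^ \<phi> = of_nat q * ((\<eta> - 1) * ev1 K \<eta> - 1)"
          using van[OF \<eta>] by simp
        then have "of_nat q = - ((1 - \<eta>) ^ \<phi>) - of_nat q * (1 - \<eta>) * ev1 K \<eta>"
          by (simp add: algebra_simps)
        also have "\<dots> = - ((1 - \<eta>) ^ (Suc i + (\<phi> - Suc i)))
            - ((1 - \<eta>) ^ i * ev1 C \<eta>) * (1 - \<eta>) * ev1 K \<eta>"
          using C[OF \<eta>] Suc.prems by simp
        also have "\<dots> = (1 - \<eta>) ^ Suc i * ev1 (- ((1 - Y) ^ (\<phi> - Suc i)) - C * K) \<eta>"
          unfolding power_add by (simp add: ev1_simps evY algebra_simps)
        finally show ?thesis .
      qed
      then show ?case by blast
    qed
  qed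
  from unit[OF order_refl] obtain B where
    "\<And>\<eta>. \<eta> ^ (q ^ Suc k) = 1 \<Longrightarrow> \<eta> ^ (q ^ k) \<noteq> 1 \<Longrightarrow> of_nat q = (1 - \<eta>) ^ \<phi> * ev1 B \<eta>"
    by blast
  with van[OF order_refl] show ?thesis
    by blast
qed

section \<open>Linear relations between powers of a root of unity of prime order\<close>

text \<open>
  With \<open>\<pi> = 1 - \<zeta>\<close>, the prime \<open>p\<close> is associated to \<open>\<pi>\<^sup>p\<^sup>-\<^sup>1\<close>.  If the coefficients below \<open>k\<close> are divisible by \<open>p\<close>, a
  relation of degree less than \<open>p - 1\<close> shows that \<open>\<pi>\<close> divides the \<open>k\<close>-th coefficient; taking the
  \<open>(p - 1)\<close>-st power, \<open>p\<close> divides a power of this integer.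
\<close>

lemma prime_dvd_coeffs_of_relation:
  assumes p: "prime p" and \<zeta>: "\<zeta> ^ p = 1" "\<zeta> \<noteq> 1"
    and G: "ev1 G (1 - \<zeta>) = 0" "degree G < p - 1"
  shows "int p dvd coeff G k"
proof (induction k rule: less_induct)
  case (less k)
  define \<pi> where "\<pi> = 1 - \<zeta>"
  have p1: "p > 1" using p prime_gt_1_nat by blast
  have "p - 1 = p ^ 0 * (p - 1)" by simp
  from totally_ramified[OF p this] obtain A B where
    "\<forall>\<eta>. \<eta> ^ (p ^ Suc 0) = 1 \<and> \<eta> ^ (p ^ 0) \<noteq> 1 \<longrightarrow>
      (1 - \<eta>) ^ (p - 1) = of_nat p * ev1 A \<eta> \<and> of_nat p = (1 - \<eta>) ^ (p - 1) * ev1 B \<eta>"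
    by blast
  moreover have "\<zeta> ^ (p ^ Suc 0) = 1 \<and> \<zeta> ^ (p ^ 0) \<noteq> 1" using \<zeta> by simp
  ultimately have A: "\<pi> ^ (p - 1) = of_nat p * ev1 A \<zeta>"
    and B: "of_nat p = \<pi> ^ (p - 1) * ev1 B \<zeta>" unfolding \<pi>_def by blast+
  show ?case
  proof (cases "k < p - 1")
    case False
    then show ?thesis using G(2) by (simp add: coeff_eq_0)
  next
    case True
    define L where "L = (\<Sum>i<k. monom (coeff G i div int p) i)"
    define R where "R = (\<Sum>i\<in>{k<..<p - 1}. monom (coeff G i) (i - Suc k))"
    have "(\<Sum>i<p - 1. monom (coeff G i) i) = G"
      using G(2) by (intro poly_eqI) (auto simp: coeff_sum sum.delta' coeff_eq_0)
    then have "ev1 G \<pi> = ev1 (\<Sum>i<p - 1. monom (coeff G i) i) \<pi>" by (simp only:)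
    also have "\<dots> = (\<Sum>i<p - 1. of_int (coeff G i) * \<pi> ^ i)" by (simp only: ev1_simps)
    also have "{..<p - 1} = {..<k} \<union> insert k {k<..<p - 1}" using True by auto
    also have "(\<Sum>i\<in>\<dots>. of_int (coeff G i) * \<pi> ^ i) = (\<Sum>i<k. of_int (coeff G i) * \<pi> ^ i)
        + of_int (coeff G k) * \<pi> ^ k + (\<Sum>i\<in>{k<..<p - 1}. of_int (coeff G i) * \<pi> ^ i)"
      by (subst sum.union_disjoint) auto
    finally have "ev1 G \<pi> = (\<Sum>i<k. of_int (coeff G i) * \<pi> ^ i) + of_int (coeff G k) * \<pi> ^ k
        + (\<Sum>i\<in>{k<..<p - 1}. of_int (coeff G i) * \<pi> ^ i)" .
    moreover have "(\<Sum>i<k. of_int (coeff G i) * \<pi> ^ i) = of_nat p * ev1 L \<pi>"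
      unfolding L_def ev1_simps sum_distrib_left
    proof (rule sum.cong)
      fix i assume "i \<in> {..<k}"
      then have "int p * (coeff G i div int p) = coeff G i" using less.IH by simp
      then have "(of_int (int p * (coeff G i div int p)) :: complex) = of_int (coeff G i)"
        by (simp only:)
      then have "(of_int (coeff G i) :: complex) = of_nat p * of_int (coeff G i div int p)"
        by (simp only: of_int_mult of_int_of_nat_eq)
      then show "of_int (coeff G i) * \<pi> ^ i = of_nat p * (of_int (coeff G i div int p) * \<pi> ^ i)"
        by (simp only: mult.assoc)
    qed simp
    moreover have "(\<Sum>i\<in>{k<..<p - 1}. of_int (coeff G i) * \<pi> ^ i) = \<pi> ^ Suc k * ev1 R \<pi>"
      unfolding R_def ev1_simps sum_distrib_left
    proof (rule sum.cong)
      fix i assume "i \<in> {k<..<p - 1}"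
      then have e: "Suc k + (i - Suc k) = i" by simp
      have "\<pi> ^ i = \<pi> ^ Suc k * \<pi> ^ (i - Suc k)"
        unfolding power_add[symmetric] e ..
      then show "of_int (coeff G i) * \<pi> ^ i = \<pi> ^ Suc k * (of_int (coeff G i) * \<pi> ^ (i - Suc k))"
        by (simp only: mult_ac)
    qed simp
    moreover have "(of_nat p :: complex) = \<pi> ^ Suc k * (\<pi> ^ (p - 1 - Suc k) * ev1 B \<zeta>)"
    proof -
      have e: "Suc k + (p - 1 - Suc k) = p - 1" using True by simp
      from B have "of_nat p = \<pi> ^ (Suc k + (p - 1 - Suc k)) * ev1 B \<zeta>"
        unfolding e .
      then show ?thesis unfolding power_add by (simp only: mult.assoc)
    qed
    ultimately have "0 = \<pi> ^ Suc k * (\<pi> ^ (p - 1 - Suc k) * ev1 B \<zeta>) * ev1 L \<pi>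
        + of_int (coeff G k) * \<pi> ^ k + \<pi> ^ Suc k * ev1 R \<pi>"
      using G(1) unfolding \<pi>_def[symmetric] by (simp only:)
    also have "\<dots> = \<pi> ^ k * (of_int (coeff G k)
        + \<pi> * (\<pi> ^ (p - 1 - Suc k) * ev1 B \<zeta> * ev1 L \<pi> + ev1 R \<pi>))"
      by (simp add: algebra_simps del: power_Suc add: power_Suc2)
    finally have eq: "of_int (coeff G k)
        = - (\<pi> * (\<pi> ^ (p - 1 - Suc k) * ev1 B \<zeta> * ev1 L \<pi> + ev1 R \<pi>))"
      using \<zeta>(2) by (simp add: \<pi>_def eq_neg_iff_add_eq_0)
    define W where "W = - ([:1,-1:] ^ (p - 1 - Suc k) * B * pcompose L [:1,-1:] + pcompose R [:1,-1:])"
    have "ev1 W \<zeta> = - (\<pi> ^ (p - 1 - Suc k) * ev1 B \<zeta> * ev1 L \<pi> + ev1 R \<pi>)"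
      by (simp add: W_def ev1_simps ev1_pcompose \<pi>_def)
    then have "of_int (coeff G k) = \<pi> * ev1 W \<zeta>"
      unfolding eq by (simp only: mult_minus_right)
    then have "of_int (coeff G k ^ (p - 1)) = of_int (int p) * ev1 (A * W ^ (p - 1)) \<zeta>"
      by (simp only: of_int_power power_mult_distrib A ev1_simps of_int_of_nat_eq mult.assoc)
    then have "int p dvd coeff G k ^ (p - 1)"
      using int_dvd_of_ev1[of \<zeta> p "int p"] \<zeta> p p1 by simp
    then show ?thesis using p by (simp add: prime_dvd_power)
  qed
qed

text \<open>
  Subtracting a multiple of \<open>1 + \<zeta> + ... + \<zeta>\<^sup>p\<^sup>-\<^sup>1 = 0\<close> makes the degree less than \<open>p - 1\<close>.  A nonzero
  relation could then be expanded in powers of \<open>1 - \<zeta>\<close> and taken primitive, against the previous lemma.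
\<close>

lemma prime_root_of_unity_relation:
  fixes c :: "nat \<Rightarrow> int" and \<zeta> :: complex
  assumes p: "prime p" and \<zeta>: "\<zeta> ^ p = 1" "\<zeta> \<noteq> 1"
    and rel: "(\<Sum>k<p. of_int (c k) * \<zeta> ^ k) = 0" and "k < p" "l < p"
  shows "c k = c l"
proof -
  have p1: "p > 1" using p prime_gt_1_nat by blast
  define g where "g = (\<Sum>k<p. monom (c k - c (p - 1)) k)"
  have cf: "coeff g i = (if i < p then c i - c (p - 1) else 0)" for i
    by (simp add: g_def coeff_sum sum.delta')
  have "(1 - \<zeta>) * (\<Sum>k<p. \<zeta> ^ k) = 0"
    using \<zeta> one_diff_power_eq[of \<zeta> p] by simp
  then have "(\<Sum>k<p. \<zeta> ^ k) = 0" using \<zeta>(2) by simp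
  then have g0: "ev1 g \<zeta> = 0"
    using rel by (simp add: g_def ev1_simps left_diff_distrib sum_subtractf sum_distrib_left[symmetric])
  define G where "G = pcompose g [:1, -1:]"
  have G0: "ev1 G (1 - \<zeta>) = 0" using g0 by (simp add: G_def ev1_pcompose)
  have "degree g \<le> p - 2"
  proof (rule degree_le, intro allI impI)
    fix i assume "p - 2 < i"
    then have "i = p - 1 \<or> \<not> i < p" by linarith
    then show "coeff g i = 0" using cf by auto
  qed
  have "G = 0"
  proof (rule ccontr)
    assume "G \<noteq> 0"
    then have "g \<noteq> 0" by (auto simp: G_def)
    let ?P = "primitive_part G"
    have "degree ?P = degree g" by (simp add: G_def degree_pcompose)
    also have "\<dots> < p - 1" using \<open>degree g \<le> p - 2\<close> p1 by simp
    finally have "degree ?P < p - 1" .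
    have "ev1 (smult (content G) ?P) (1 - \<zeta>) = 0" using G0 by simp
    then have "ev1 ?P (1 - \<zeta>) = 0" using \<open>G \<noteq> 0\<close>
      by (simp add: ev1_simps del: content_times_primitive_part)
    then have "[:int p:] dvd ?P"
      unfolding const_poly_dvd_iff
      using prime_dvd_coeffs_of_relation[OF p \<zeta> _ \<open>degree ?P < p - 1\<close>] by blast
    then have "int p dvd content ?P" by (simp add: const_poly_dvd_iff_dvd_content)
    then show False using \<open>G \<noteq> 0\<close> p1 by simp
  qed
  then have "g = 0" unfolding G_def by (rule pcompose_eq_0) simp
  then show ?thesis using cf[of k] cf[of l] assms(5,6) by simp
qed

section \<open>The ring of polynomial functions on a set of roots of unity\<close>

lemma ev2_induct:
  fixes P :: "(complex \<Rightarrow> complex) \<Rightarrow> bool"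
  assumes int: "\<And>c. P (\<lambda>x. of_int c)" and zeta: "P (\<lambda>x. \<zeta>)" and var: "P (\<lambda>x. x)"
    and add: "\<And>f g. P f \<Longrightarrow> P g \<Longrightarrow> P (\<lambda>x. f x + g x)"
    and mult: "\<And>f g. P f \<Longrightarrow> P g \<Longrightarrow> P (\<lambda>x. f x * g x)"
  shows "P (ev2 \<zeta> F)"
proof -
  have const: "P (\<lambda>x. ev1 c \<zeta>)" for c
  proof (induction c)
    case 0
    show ?case using int[of 0] by simp
  next
    case (pCons a c)
    show ?case using add[OF int[of a] mult[OF zeta pCons.IH]] by simp
  qed
  have "P (\<lambda>x. ev2 \<zeta> F x)"
  proof (induction F)
    case 0
    show ?case using int[of 0] by simp
  next
    case (pCons c F)
    show ?case using add[OF const[of c] mult[OF var pCons.IH]] by simp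
  qed
  then show ?thesis .
qed

lemma dvd_power_prime_power_diff:
  fixes c :: int
  assumes q: "prime q"
  shows "int q dvd c ^ (q ^ j) - c"
proof (induction c rule: int_induct[where k = 0])
  case base
  show ?case using q by (simp add: power_0_left prime_gt_0_nat)
next
  case (step1 c)
  from dvd_add[OF prime_dvd_binomial_power[OF q, of c 1 j] step1(2)] show ?case
    by (simp add: algebra_simps)
next
  case (step2 c)
  from dvd_diff[OF step2(2) prime_dvd_binomial_power[OF q, of "c - 1" 1 j]] show ?case
    by (simp add: algebra_simps)
qed

lemma cnj_root: "x ^ m = 1 \<Longrightarrow> m > 0 \<Longrightarrow> cnj x = x ^ (m - 1)" for x :: complex
proof -
  assume x: "x ^ m = 1" "m > 0"
  then have "norm x = 1" using power_eq_1_iff[of x m] by simp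
  then have "x * cnj x = 1" by (simp add: complex_norm_square[symmetric])
  moreover have "x * x ^ (m - 1) = 1" using x by (cases m) simp_all
  ultimately show ?thesis by (metis mult_cancel_left mult_zero_left zero_neq_one)
qed

lemma root_mult_cnj: "x ^ m = 1 \<Longrightarrow> m > 0 \<Longrightarrow> x * cnj x = 1" for x :: complex
  using cnj_root[of x m] by (cases m) simp_all

text \<open>
  All divisibility statements refer to functions on a set \<open>D\<close> of \<open>u\<close>-th roots of unity.  The larger
  \<open>D\<close> is, the more is known about the common quotient: a single point suffices for parity, all
  \<open>u\<close>-th roots are needed for counting.
\<close>

locale value_ring =
  fixes p u :: nat and \<zeta> :: complex and D :: "complex set"
  assumes p_pos: "p > 0" and u_pos: "u > 0" and zeta_p: "\<zeta> ^ p = 1"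
    and D_roots: "\<And>x. x \<in> D \<Longrightarrow> x ^ u = 1"
begin

text \<open>Only the values on \<open>D\<close> matter, so that pointwise conjugation stays inside this ring of functions.\<close>

definition VR :: "(complex \<Rightarrow> complex) set" where
  "VR = {f. \<exists>F. \<forall>x\<in>D. f x = ev2 \<zeta> F x}"

definition vdvd :: "(complex \<Rightarrow> complex) \<Rightarrow> (complex \<Rightarrow> complex) \<Rightarrow> bool" where
  "vdvd g f \<longleftrightarrow> (\<exists>h\<in>VR. \<forall>x\<in>D. f x = g x * h x)"

lemma VR_I: "(\<And>x. x \<in> D \<Longrightarrow> f x = ev2 \<zeta> F x) \<Longrightarrow> f \<in> VR"
  by (auto simp: VR_def)

lemma VR_cong: "f \<in> VR \<Longrightarrow> (\<And>x. x \<in> D \<Longrightarrow> g x = f x) \<Longrightarrow> g \<in> VR"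
  by (auto simp: VR_def)

lemma VR_ev2: "ev2 \<zeta> F \<in> VR"
  by (rule VR_I) simp

lemma VR_of_int: "(\<lambda>x. of_int c) \<in> VR"
  by (rule VR_I[of _ "of_int c"]) (simp add: ev2_simps)

lemma VR_of_nat: "(\<lambda>x. of_nat c) \<in> VR"
  using VR_of_int[of "int c"] by simp

lemma VR_1: "(\<lambda>x. 1) \<in> VR"
  using VR_of_nat[of 1] by simp

lemma VR_var: "(\<lambda>x. x) \<in> VR"
  by (rule VR_I[of _ "[:0, 1:]"]) simp

lemma VR_zeta: "(\<lambda>x. \<zeta>) \<in> VR"
  by (rule VR_I[of _ "[:[:0, 1:]:]"]) simp

lemma VR_add: "f \<in> VR \<Longrightarrow> g \<in> VR \<Longrightarrow> (\<lambda>x. f x + g x) \<in> VR"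
  unfolding VR_def by (auto simp flip: ev1_hom.eval_add)

lemma VR_mult: "f \<in> VR \<Longrightarrow> g \<in> VR \<Longrightarrow> (\<lambda>x. f x * g x) \<in> VR"
  unfolding VR_def by (auto simp flip: ev1_hom.eval_mult)

lemma VR_power: "f \<in> VR \<Longrightarrow> (\<lambda>x. f x ^ n) \<in> VR"
  unfolding VR_def by (auto simp flip: ev1_hom.eval_power)

lemma VR_minus: "f \<in> VR \<Longrightarrow> (\<lambda>x. - f x) \<in> VR"
  unfolding VR_def by (auto simp flip: ev1_hom.eval_minus)

lemma VR_diff: "f \<in> VR \<Longrightarrow> g \<in> VR \<Longrightarrow> (\<lambda>x. f x - g x) \<in> VR"
  unfolding VR_def by (auto simp flip: ev1_hom.eval_diff)

lemma VR_ev1: "f \<in> VR \<Longrightarrow> (\<lambda>x. ev1 C (f x)) \<in> VR"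
proof (induction C)
  case 0
  then show ?case using VR_of_int[of 0] by simp
next
  case (pCons a C)
  show ?case
    using VR_add[OF VR_of_int[of a] VR_mult[OF pCons.prems pCons.IH[OF pCons.prems]]] by simp
qed

text \<open>On roots of unity, conjugation is inversion and therefore a power map.\<close>

lemma VR_cnj:
  assumes "f \<in> VR"
  shows "(\<lambda>x. cnj (f x)) \<in> VR"
proof -
  obtain F where F: "\<And>x. x \<in> D \<Longrightarrow> f x = ev2 \<zeta> F x" using assms by (auto simp: VR_def)
  have "(\<lambda>x. cnj (ev2 \<zeta> F x)) \<in> VR"
  proof (induction rule: ev2_induct)
    case (1 c)
    show ?case using VR_of_int[of c] by simp
  next
    case 2
    show ?case using VR_power[OF VR_zeta, of "p - 1"] cnj_root[OF zeta_p p_pos] by simp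
  next
    case 3
    show ?case
      by (rule VR_cong[OF VR_power[OF VR_var, of "u - 1"]]) (rule cnj_root[OF D_roots u_pos])
  next
    case (4 f g)
    then show ?case using VR_add by simp
  next
    case (5 f g)
    then show ?case using VR_mult by simp
  qed
  then show ?thesis by (rule VR_cong) (simp add: F)
qed

lemma vdvd_I: "h \<in> VR \<Longrightarrow> (\<And>x. x \<in> D \<Longrightarrow> f x = g x * h x) \<Longrightarrow> vdvd g f"
  by (auto simp: vdvd_def)

lemma vdvd_E:
  assumes "vdvd g f"
  obtains h where "h \<in> VR" "\<And>x. x \<in> D \<Longrightarrow> f x = g x * h x"
  using assms by (auto simp: vdvd_def)

lemma vdvd_add:
  assumes "vdvd g f1" "vdvd g f2"
  shows "vdvd g (\<lambda>x. f1 x + f2 x)"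
proof -
  obtain h1 h2 where "h1 \<in> VR" "\<And>x. x \<in> D \<Longrightarrow> f1 x = g x * h1 x"
    "h2 \<in> VR" "\<And>x. x \<in> D \<Longrightarrow> f2 x = g x * h2 x"
    using assms by (auto elim!: vdvd_E)
  then show ?thesis
    by (intro vdvd_I[OF VR_add[of h1 h2]]) (simp_all add: distrib_left)
qed

lemma vdvd_mult:
  assumes "vdvd g f" "k \<in> VR"
  shows "vdvd g (\<lambda>x. f x * k x)"
proof -
  obtain h where "h \<in> VR" "\<And>x. x \<in> D \<Longrightarrow> f x = g x * h x"
    using assms by (auto elim!: vdvd_E)
  then show ?thesis
    by (intro vdvd_I[OF VR_mult[of h k]]) (simp_all add: assms)
qed

lemma vdvd_minus:
  assumes "vdvd g f"
  shows "vdvd g (\<lambda>x. - f x)"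
proof -
  have "vdvd g (\<lambda>x. f x * of_int (-1))" by (rule vdvd_mult[OF assms VR_of_int])
  then show ?thesis by simp
qed

lemma vdvd_cong:
  assumes "vdvd g f" "\<And>x. x \<in> D \<Longrightarrow> f' x = f x"
  shows "vdvd g f'"
  using assms by (auto simp: vdvd_def)

lemma vdvd_0: "vdvd g (\<lambda>x. 0)"
  by (rule vdvd_I[OF VR_of_int[of 0]]) simp

lemma vdvd_trans:
  assumes "vdvd g f" "vdvd f k"
  shows "vdvd g k"
proof -
  obtain h1 h2 where "h1 \<in> VR" "\<And>x. x \<in> D \<Longrightarrow> f x = g x * h1 x"
    "h2 \<in> VR" "\<And>x. x \<in> D \<Longrightarrow> k x = f x * h2 x"
    using assms by (auto elim!: vdvd_E)
  then show ?thesis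
    by (intro vdvd_I[OF VR_mult[of h1 h2]]) simp_all
qed

lemma vdvd_cnj:
  assumes "vdvd g f"
  shows "vdvd (\<lambda>x. cnj (g x)) (\<lambda>x. cnj (f x))"
proof -
  obtain h where "h \<in> VR" "\<And>x. x \<in> D \<Longrightarrow> f x = g x * h x"
    using assms by (auto elim!: vdvd_E)
  then show ?thesis by (intro vdvd_I[OF VR_cnj[of h]]) simp_all
qed

lemma vdvd_power:
  assumes "vdvd g f"
  shows "vdvd (\<lambda>x. g x ^ n) (\<lambda>x. f x ^ n)"
proof -
  obtain h where "h \<in> VR" "\<And>x. x \<in> D \<Longrightarrow> f x = g x * h x"
    using assms by (rule vdvd_E) blast
  then show ?thesis
    by (intro vdvd_I[OF VR_power[of h n]]) (simp_all add: power_mult_distrib)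
qed

lemma vdvd_power_le:
  assumes "g \<in> VR" "m \<le> n"
  shows "vdvd (\<lambda>x. g x ^ m) (\<lambda>x. g x ^ n)"
  by (rule vdvd_I[OF VR_power[OF assms(1), of "n - m"]])
    (use assms(2) in \<open>simp flip: power_add\<close>)

lemma binomial_power_vdvd:
  assumes "prime q" "f \<in> VR" "g \<in> VR"
  shows "vdvd (\<lambda>x. of_nat q) (\<lambda>x. (f x + g x) ^ (q ^ j) - (f x ^ (q ^ j) + g x ^ (q ^ j)))"
proof -
  obtain F G where F: "\<And>x. x \<in> D \<Longrightarrow> f x = ev2 \<zeta> F x" and G: "\<And>x. x \<in> D \<Longrightarrow> g x = ev2 \<zeta> G x"
    using assms by (auto simp: VR_def)
  obtain H where "(F + G) ^ (q ^ j) - (F ^ (q ^ j) + G ^ (q ^ j)) = of_nat q * H"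
    using prime_dvd_binomial_power[OF assms(1), of F G j] by (auto elim: dvdE)
  then have "ev2 \<zeta> ((F + G) ^ (q ^ j) - (F ^ (q ^ j) + G ^ (q ^ j))) x = ev2 \<zeta> (of_nat q * H) x" for x
    by simp
  then show ?thesis
    by (intro vdvd_I[OF VR_ev2[of H]]) (simp add: F G ev2_simps)
qed

end

section \<open>Self-conjugate primes and norms\<close>

text \<open>
  The element \<open>\<pi>\<close> plays the part of a prime above \<open>q\<close> that is stable under conjugation: raising to the
  power \<open>q\<^sup>j\<close> inverts \<open>\<zeta>\<close> exactly and inverts \<open>x\<close> modulo \<open>\<pi>\<close>.
\<close>

locale self_conjugate_prime = value_ring +
  fixes q j :: nat and \<pi> :: "complex \<Rightarrow> complex"
  assumes q: "prime q" and p_dvd: "p dvd q ^ j + 1" and j_pos: "j > 0"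
    and \<pi>_VR: "\<pi> \<in> VR" and \<pi>_dvd_q: "vdvd \<pi> (\<lambda>x. of_nat q)"
    and \<pi>_dvd_var: "vdvd \<pi> (\<lambda>x. x ^ (q ^ j + 1) - 1)"
    and \<pi>_cnj: "vdvd \<pi> (\<lambda>x. cnj (\<pi> x))"
    and \<pi>_nz: "\<And>x. x \<in> D \<Longrightarrow> \<pi> x \<noteq> 0"
begin

text \<open>Frobenius is additive modulo \<open>q\<close>, so it suffices to check the generators of the ring.\<close>

lemma frobenius_conjugates:
  assumes "f \<in> VR"
  shows "vdvd \<pi> (\<lambda>x. f x ^ (q ^ j) - cnj (f x))"
proof -
  obtain F where F: "\<And>x. x \<in> D \<Longrightarrow> f x = ev2 \<zeta> F x" using assms by (auto simp: VR_def)
  let ?P = "\<lambda>f. f \<in> VR \<and> vdvd \<pi> (\<lambda>x. f x ^ (q ^ j) - cnj (f x))"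
  have "?P (ev2 \<zeta> F)"
  proof (induction rule: ev2_induct)
    case (1 c)
    from dvd_power_prime_power_diff[OF q, of c j]
    obtain d where "c ^ (q ^ j) - c = int q * d" by (auto elim: dvdE)
    then have "of_int (c ^ (q ^ j) - c) = (of_nat q * of_int d :: complex)" by simp
    then have "vdvd (\<lambda>x. of_nat q) (\<lambda>x. of_int c ^ (q ^ j) - cnj (of_int c))"
      by (intro vdvd_I[OF VR_of_int[of d]]) simp
    then show ?case using VR_of_int vdvd_trans[OF \<pi>_dvd_q] by blast
  next
    case 2
    have "\<zeta> \<noteq> 0" using zeta_p p_pos by (auto simp: power_0_left)
    obtain m where "q ^ j + 1 = p * m" using p_dvd by (auto elim: dvdE)
    then have "\<zeta> ^ (q ^ j) * \<zeta> = 1"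
      using zeta_p power_add[of \<zeta> "q ^ j" 1] power_mult[of \<zeta> p m] by simp
    also have "1 = cnj \<zeta> * \<zeta>" using root_mult_cnj[OF zeta_p p_pos] by (simp add: mult.commute)
    finally have "\<zeta> ^ (q ^ j) = cnj \<zeta>" using \<open>\<zeta> \<noteq> 0\<close> by simp
    then show ?case using VR_zeta vdvd_0 by simp
  next
    case 3
    have "vdvd \<pi> (\<lambda>x. (x ^ (q ^ j + 1) - 1) * cnj x)"
      by (rule vdvd_mult[OF \<pi>_dvd_var VR_cnj[OF VR_var]])
    moreover have "x ^ (q ^ j) - cnj x = (x ^ (q ^ j + 1) - 1) * cnj x" if "x \<in> D" for x
      using root_mult_cnj[OF D_roots[OF that] u_pos] by (simp add: algebra_simps)
    ultimately show ?case using VR_var by (blast intro: vdvd_cong)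
  next
    case (4 f g)
    have "vdvd \<pi> (\<lambda>x. ((f x + g x) ^ (q ^ j) - (f x ^ (q ^ j) + g x ^ (q ^ j)))
        + ((f x ^ (q ^ j) - cnj (f x)) + (g x ^ (q ^ j) - cnj (g x))))"
      using 4 by (intro vdvd_add vdvd_trans[OF \<pi>_dvd_q binomial_power_vdvd[OF q]]) auto
    then show ?case using 4 VR_add by (simp add: algebra_simps)
  next
    case (5 f g)
    have "vdvd \<pi> (\<lambda>x. (f x ^ (q ^ j) - cnj (f x)) * g x ^ (q ^ j)
        + (g x ^ (q ^ j) - cnj (g x)) * cnj (f x))"
      using 5 by (intro vdvd_add vdvd_mult VR_power VR_cnj) auto
    then show ?case using 5 VR_mult by (simp add: algebra_simps power_mult_distrib)
  qed
  then show ?thesis by (auto intro: vdvd_cong simp: F)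
qed

text \<open>
  Modulo \<open>\<pi>\<close> and with \<open>Q = q\<^sup>j \<ge> 2\<close>, \<open>f\<close> is the \<open>Q\<close>-th power of its conjugate, so \<open>f\<^sup>2\<close> is a
  multiple of the norm and vanishes.  The conjugate of \<open>f\<close>, being \<open>f\<^sup>Q\<close>, then vanishes as well,
  and so does \<open>f\<close>, since the multiples of \<open>\<pi>\<close> are stable under conjugation.
\<close>

lemma dvd_of_dvd_norm:
  assumes f: "f \<in> VR" and "vdvd \<pi> (\<lambda>x. f x * cnj (f x))"
  shows "vdvd \<pi> f"
proof -
  let ?Q = "q ^ j"
  have Q: "?Q \<ge> 2"
    using self_le_power[of q j] prime_ge_2_nat[OF q] j_pos by linarith
  note fc = VR_cnj[OF f]
  have "vdvd \<pi> (\<lambda>x. cnj (f x) ^ ?Q - cnj (cnj (f x)))"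
    by (rule frobenius_conjugates[OF fc])
  from vdvd_add[OF vdvd_mult[OF vdvd_minus[OF this] f]
      vdvd_mult[OF assms(2) VR_power[OF fc, of "?Q - 1"]]]
  have "vdvd \<pi> (\<lambda>x. f x ^ 2)"
  proof (rule vdvd_cong)
    fix x
    have "cnj (f x) ^ ?Q = cnj (f x) * cnj (f x) ^ (?Q - 1)"
    proof -
      have "Suc (?Q - 1) = ?Q" using Q by linarith
      then show ?thesis by (simp only: power_Suc[symmetric])
    qed
    then show "f x ^ 2 = - (cnj (f x) ^ ?Q - cnj (cnj (f x))) * f x
        + f x * cnj (f x) * cnj (f x) ^ (?Q - 1)"
      by (simp add: algebra_simps power2_eq_square)
  qed
  from vdvd_add[OF vdvd_minus[OF frobenius_conjugates[OF f]]
      vdvd_mult[OF this VR_power[OF f, of "?Q - 2"]]]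
  have "vdvd \<pi> (\<lambda>x. cnj (f x))"
  proof (rule vdvd_cong)
    fix x
    have "f x ^ ?Q = f x ^ 2 * f x ^ (?Q - 2)"
    proof -
      have "2 + (?Q - 2) = ?Q" using Q by linarith
      then show ?thesis by (simp only: power_add[symmetric])
    qed
    then show "cnj (f x) = - (f x ^ ?Q - cnj (f x)) + f x ^ 2 * f x ^ (?Q - 2)"
      by simp
  qed
  from vdvd_trans[OF \<pi>_cnj vdvd_cnj[OF this]] show ?thesis by simp
qed

text \<open>
  Dividing \<open>f\<close> by \<open>\<pi>\<close> divides the norm by \<open>\<pi>\<close> times its conjugate, which is \<open>\<pi>\<^sup>2\<close> times a unit.
\<close>

lemma power_dvd_of_power_dvd_norm:
  assumes "f \<in> VR" "vdvd (\<lambda>x. \<pi> x ^ t) (\<lambda>x. f x * cnj (f x))"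
  shows "vdvd (\<lambda>x. \<pi> x ^ ((t + 1) div 2)) f"
  using assms
proof (induction t arbitrary: f rule: nat_less_induct)
  case (1 t)
  have "t = 0 \<or> t = 1 \<or> t = (t - 2) + 2" by linarith
  then consider "t = 0" | "t = 1" | s where "t = s + 2" by blast
  then show ?case
  proof cases
    case 1
    then show ?thesis using "1.prems"(1) by (intro vdvd_I[of f]) auto
  next
    case 2
    then show ?thesis using dvd_of_dvd_norm "1.prems" by simp
  next
    case 3
    have "vdvd \<pi> (\<lambda>x. \<pi> x ^ t)"
      using vdvd_power_le[OF \<pi>_VR, of 1 t] 3 by simp
    from dvd_of_dvd_norm[OF "1.prems"(1) vdvd_trans[OF this "1.prems"(2)]]
    obtain g where g: "g \<in> VR" and fg: "\<And>x. x \<in> D \<Longrightarrow> f x = \<pi> x * g x"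
      unfolding vdvd_def by blast
    obtain e where e: "e \<in> VR" and \<pi>e: "\<And>x. x \<in> D \<Longrightarrow> cnj (\<pi> x) = \<pi> x * e x"
      using \<pi>_cnj unfolding vdvd_def by blast
    obtain h where h: "h \<in> VR" and fh: "\<And>x. x \<in> D \<Longrightarrow> f x * cnj (f x) = \<pi> x ^ t * h x"
      using "1.prems"(2) unfolding vdvd_def by blast
    have "vdvd (\<lambda>x. \<pi> x ^ s) (\<lambda>x. g x * cnj (g x))"
    proof (rule vdvd_I[OF VR_mult[OF h VR_cnj[OF e]]])
      fix x assume x: "x \<in> D"
      \<comment> \<open>The factor relating \<open>\<pi>\<close> to its conjugate is a unit, since conjugating twice is the identity.\<close>
      have "\<pi> x * 1 = cnj (cnj (\<pi> x))" by simp
      also have "\<dots> = \<pi> x * (e x * cnj (e x))"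
        unfolding \<pi>e[OF x] complex_cnj_mult unfolding \<pi>e[OF x] by (simp only: mult.assoc)
      finally have unit: "e x * cnj (e x) = 1"
        using \<pi>_nz[OF x] by (metis mult_left_cancel)
      have "\<pi> x ^ 2 * (e x * (g x * cnj (g x))) = f x * cnj (f x)"
        using fg[OF x] \<pi>e[OF x] by (simp add: power2_eq_square algebra_simps)
      also have "\<dots> = \<pi> x ^ 2 * (\<pi> x ^ s * h x)"
        unfolding fh[OF x] 3 by (simp only: power_add mult_ac)
      finally have "e x * (g x * cnj (g x)) = \<pi> x ^ s * h x"
        using \<pi>_nz[OF x] by simp
      then have "cnj (e x) * (e x * (g x * cnj (g x))) = cnj (e x) * (\<pi> x ^ s * h x)" by (simp only:)
      then have "(e x * cnj (e x)) * (g x * cnj (g x)) = \<pi> x ^ s * (h x * cnj (e x))"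
        by (simp only: mult_ac)
      then show "g x * cnj (g x) = \<pi> x ^ s * (h x * cnj (e x))" unfolding unit by simp
    qed
    then have "vdvd (\<lambda>x. \<pi> x ^ ((s + 1) div 2)) g"
      using "1.IH"[rule_format, of s g] g 3 by simp
    then obtain k where "k \<in> VR" "\<And>x. x \<in> D \<Longrightarrow> g x = \<pi> x ^ ((s + 1) div 2) * k x"
      unfolding vdvd_def by blast
    then show ?thesis
      using fg 3 by (intro vdvd_I[of k]) simp_all
  qed
qed

end

context value_ring
begin

text \<open>Here \<open>\<pi> = q\<close>, and \<open>x\<close> is inverted exactly, not only modulo \<open>\<pi>\<close>.\<close>

lemma unramified_divisibility:
  assumes q: "prime q" and "p dvd q ^ j + 1" "u dvd q ^ j + 1" "j > 0"
    and f: "f \<in> VR" "vdvd (\<lambda>x. of_nat q ^ r) (\<lambda>x. f x * cnj (f x))"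
  shows "vdvd (\<lambda>x. of_nat q ^ ((r + 1) div 2)) f"
proof -
  interpret self_conjugate_prime p u \<zeta> D q j "\<lambda>x. of_nat q"
  proof unfold_locales
    show "vdvd (\<lambda>x. of_nat q) (\<lambda>x. of_nat q)" "vdvd (\<lambda>x. of_nat q) (\<lambda>x. cnj (of_nat q))"
      by (rule vdvd_I[OF VR_1]; simp)+
    show "vdvd (\<lambda>x. of_nat q) (\<lambda>x. x ^ (q ^ j + 1) - 1)"
    proof (rule vdvd_cong[OF vdvd_0])
      fix x assume "x \<in> D"
      obtain m where m: "q ^ j + 1 = u * m" using assms(3) by (rule dvdE)
      show "x ^ (q ^ j + 1) - 1 = 0"
        unfolding m power_mult using D_roots[OF \<open>x \<in> D\<close>] by simp
    qed
    show "of_nat q \<noteq> (0::complex)" for x :: complex using q by (simp add: prime_gt_0_nat)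
  qed (use assms VR_of_nat in auto)
  show ?thesis by (rule power_dvd_of_power_dvd_norm[OF f])
qed

text \<open>
  On \<open>D\<close> the power \<open>x\<^sup>w\<close> has exact order \<open>q\<^sup>k\<^sup>+\<^sup>1\<close>.  Here \<open>\<pi> = 1 - x\<^sup>w\<close>, so that \<open>x\<close> satisfies
  \<open>x\<^sup>w = 1\<close> modulo \<open>\<pi>\<close> and is inverted by the power map although \<open>q\<close> divides the order of \<open>x\<close>.
  The exponent is halved with rounding down, because \<open>\<phi> r\<close> may be even when \<open>r\<close> is odd.
\<close>

lemma ramified_divisibility:
  assumes q: "prime q" and "p dvd q ^ j + 1" "j > 0"
    and u: "u = q ^ Suc k * w" "w dvd q ^ j + 1"
    and D: "\<And>x. x \<in> D \<Longrightarrow> x ^ (q ^ k * w) \<noteq> 1"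
    and f: "f \<in> VR" "vdvd (\<lambda>x. of_nat q ^ r) (\<lambda>x. f x * cnj (f x))"
  shows "vdvd (\<lambda>x. of_nat q ^ (r div 2)) f"
proof -
  let ?\<pi> = "\<lambda>x. 1 - x ^ w"
  define \<phi> where "\<phi> = q ^ k * (q - 1)"
  have q1: "q > 1" using q prime_gt_1_nat by blast
  have \<phi>0: "\<phi> > 0" using q1 by (simp add: \<phi>_def)
  obtain A B where AB: "\<forall>\<eta>. \<eta> ^ (q ^ Suc k) = 1 \<and> \<eta> ^ (q ^ k) \<noteq> 1 \<longrightarrow>
      (1 - \<eta>) ^ \<phi> = of_nat q * ev1 A \<eta> \<and> of_nat q = (1 - \<eta>) ^ \<phi> * ev1 B \<eta>"
    using totally_ramified[OF q \<phi>_def] by blast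
  have \<eta>: "(x ^ w) ^ (q ^ Suc k) = 1 \<and> (x ^ w) ^ (q ^ k) \<noteq> 1" if "x \<in> D" for x
    using D_roots[OF that] D[OF that] unfolding u(1) power_mult[symmetric] by (simp only: mult.commute) simp
  have eta_VR: "(\<lambda>x. x ^ w) \<in> VR" by (rule VR_power[OF VR_var])
  have \<pi>q: "vdvd (\<lambda>x. ?\<pi> x ^ \<phi>) (\<lambda>x. of_nat q)"
    using AB \<eta> by (intro vdvd_I[OF VR_ev1[OF eta_VR, of B]]) blast
  have q\<pi>: "vdvd (\<lambda>x. of_nat q) (\<lambda>x. ?\<pi> x ^ \<phi>)"
    using AB \<eta> by (intro vdvd_I[OF VR_ev1[OF eta_VR, of A]]) blast
  have \<pi>_VR: "?\<pi> \<in> VR" by (rule VR_diff[OF VR_1 eta_VR])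
  interpret self_conjugate_prime p u \<zeta> D q j ?\<pi>
  proof unfold_locales
    show "vdvd ?\<pi> (\<lambda>x. of_nat q)"
      using vdvd_trans[OF vdvd_power_le[OF \<pi>_VR, of 1 \<phi>] \<pi>q] \<phi>0 by simp
    show "vdvd ?\<pi> (\<lambda>x. x ^ (q ^ j + 1) - 1)"
    proof -
      obtain m where m: "q ^ j + 1 = w * m" using u(2) by (rule dvdE)
      have "x ^ (w * m) - 1 = (1 - x ^ w) * ev1 (- (\<Sum>i<m. monom 1 i)) (x ^ w)" for x :: complex
      proof -
        have "x ^ (w * m) - 1 = - (1 - (x ^ w) ^ m)" by (simp add: power_mult)
        also have "\<dots> = (1 - x ^ w) * ev1 (- (\<Sum>i<m. monom 1 i)) (x ^ w)"
          unfolding one_diff_power_eq by (simp add: ev1_simps)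
        finally show ?thesis .
      qed
      then show ?thesis unfolding m by (intro vdvd_I[OF VR_ev1[OF eta_VR]])
    qed
    show "vdvd ?\<pi> (\<lambda>x. cnj (?\<pi> x))"
    proof (rule vdvd_I[OF VR_minus[OF VR_cnj[OF eta_VR]]])
      fix x assume x: "x \<in> D"
      have "x ^ w * cnj (x ^ w) = 1"
        using root_mult_cnj[of "x ^ w" "q ^ Suc k"] \<eta>[OF x] q1 by simp
      then show "cnj (1 - x ^ w) = (1 - x ^ w) * - cnj (x ^ w)" by (simp add: left_diff_distrib)
    qed
    show "1 - x ^ w \<noteq> 0" if "x \<in> D" for x
      using \<eta>[OF that] by auto
  qed (use assms \<pi>_VR in auto)
  have "vdvd (\<lambda>x. ?\<pi> x ^ (\<phi> * r)) (\<lambda>x. f x * cnj (f x))"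
    using vdvd_trans[OF vdvd_power[OF \<pi>q, of r] f(2)] by (simp add: power_mult)
  then have "vdvd (\<lambda>x. ?\<pi> x ^ ((\<phi> * r + 1) div 2)) f"
    by (rule power_dvd_of_power_dvd_norm[OF f(1)])
  moreover have "\<phi> * (r div 2) \<le> (\<phi> * r + 1) div 2"
  proof -
    have halve: "a \<le> (b + 1) div 2" if "2 * a \<le> b" for a b :: nat using that by linarith
    have "\<phi> * (2 * (r div 2)) \<le> \<phi> * r" by (rule mult_le_mono2) simp
    then show ?thesis by (intro halve) (simp only: mult.left_commute)
  qed
  ultimately have "vdvd (\<lambda>x. ?\<pi> x ^ (\<phi> * (r div 2))) f"
    using vdvd_trans[OF vdvd_power_le[OF \<pi>_VR]] by blast
  with vdvd_power[OF q\<pi>, of "r div 2"] show ?thesis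
    unfolding power_mult by (rule vdvd_trans)
qed

end

text \<open>
  For odd \<open>r\<close> the value is divisible by \<open>q\<close> to the power \<open>(r + 1) / 2\<close>, hence its norm by \<open>q\<^sup>r\<^sup>+\<^sup>1\<close>.
\<close>

lemma even_exact_power:
  assumes z: "\<zeta> ^ p = 1" "p > 0" and x: "x ^ u = 1" "u > 0"
    and q: "prime q" and sc: "p dvd q ^ j + 1" "u dvd q ^ j + 1" "j > 0"
    and M: "ev2 \<zeta> A x * cnj (ev2 \<zeta> A x) = of_int M" and r: "exactly_divides q r M"
  shows "even r"
proof (rule ccontr)
  assume odd: "odd r"
  interpret value_ring p u \<zeta> "{x}" by unfold_locales (use z x in auto)
  obtain M' where M': "M = int q ^ r * M'"
    using r by (auto simp: exactly_divides_def elim: dvdE)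
  have nd: "\<not> int q dvd M'"
    using r unfolding exactly_divides_def M' by (simp add: mult_dvd_mono mult.commute)
  have "vdvd (\<lambda>x. of_nat q ^ r) (\<lambda>x. ev2 \<zeta> A x * cnj (ev2 \<zeta> A x))"
    by (rule vdvd_I[OF VR_of_int[of M']]) (simp add: M M')
  from unramified_divisibility[OF q sc VR_ev2 this]
  obtain h where h: "h \<in> VR" "ev2 \<zeta> A x = of_nat q ^ ((r + 1) div 2) * h x"
    unfolding vdvd_def by blast
  obtain H where H: "h x * cnj (h x) = ev2 \<zeta> H x"
    using VR_mult[OF h(1) VR_cnj[OF h(1)]] by (auto simp: VR_def)
  have "of_nat q ^ r * of_int M' = ev2 \<zeta> A x * cnj (ev2 \<zeta> A x)" using M M' by simp
  also have "\<dots> = of_nat q ^ ((r + 1) div 2 + (r + 1) div 2) * ev2 \<zeta> H x"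
    unfolding h(2) H[symmetric] power_add by simp
  also have "(r + 1) div 2 + (r + 1) div 2 = r + 1" using odd by presburger
  finally have "of_nat q ^ r * of_int M' = of_nat q ^ r * (of_nat q * ev2 \<zeta> H x)" by simp
  then have "of_int M' = of_int (int q) * ev2 \<zeta> H x" using q by auto
  then have "int q dvd M'"
    using int_dvd_of_ev2[OF z x, of "int q"] q by simp
  then show False using nd by simp
qed

text \<open>
  The exponent can be taken positive: \<open>j = 0\<close> occurs only for a modulus dividing 2, and then \<open>j = 1\<close> works too.
\<close>

lemma self_conjugate_exponent:
  assumes q: "prime q" and "self_conjugate q v"
  obtains e w j where "v = q ^ e * w" "coprime q w" "j > 0" "w dvd q ^ j + 1"
proof -
  obtain e w j where v: "v = q ^ e * w" "coprime q w" and "[int q ^ j = - 1] (mod int w)"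
    using assms(2) by (auto simp: self_conjugate_def)
  then have "int w dvd int (q ^ j + 1)" by (simp add: cong_iff_dvd_diff add.commute)
  then have w: "w dvd q ^ j + 1" by (simp only: int_dvd_int_iff)
  show ?thesis
  proof (cases "j = 0")
    case False
    then show ?thesis using that v w by blast
  next
    case True
    then have "w dvd 2" using w by (simp add: numeral_2_eq_2)
    then have "w = 1 \<or> w = 2" using prime_nat_iff two_is_prime_nat by blast
    then have "w dvd q ^ 1 + 1"
    proof
      assume "w = 2"
      then have "odd q" using v(2) by simp
      then show ?thesis using \<open>w = 2\<close> by simp
    qed simp
    then show ?thesis using that[of e w 1] v by simp
  qed
qed

lemma self_conjugate_exponent_unramified:
  assumes q: "prime q" and p: "prime p" "q \<noteq> p" and sc: "self_conjugate q (u * p)" and "\<not> q dvd u"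
  obtains j where "j > 0" "p dvd q ^ j + 1" "u dvd q ^ j + 1"
proof -
  obtain e w j where w: "u * p = q ^ e * w" "coprime q w" "j > 0" "w dvd q ^ j + 1"
    using self_conjugate_exponent[OF q sc] .
  have "\<not> q dvd u * p"
    using primes_dvd_imp_eq[OF q p(1)] assms by (auto simp: prime_dvd_mult_iff)
  then have "e = 0" using w(1) by (cases e) auto
  then have "u * p dvd q ^ j + 1" using w by simp
  then show ?thesis using that[OF w(3)] dvd_mult_left dvd_mult_right by blast
qed

lemma self_conjugate_exponent_ramified:
  assumes q: "prime q" and p: "prime p" "q \<noteq> p" and sc: "self_conjugate q (u * p)" and "q dvd u"
  obtains j k w where "j > 0" "p dvd q ^ j + 1" "w dvd q ^ j + 1" "u = q ^ Suc k * w"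
proof -
  obtain e w j where w: "u * p = q ^ e * w" "coprime q w" "j > 0" "w dvd q ^ j + 1"
    using self_conjugate_exponent[OF q sc] .
  have "coprime p (q ^ e)" using p q by (simp add: primes_coprime)
  moreover have "p dvd q ^ e * w" using w(1) by (metis dvd_triv_right)
  ultimately have "p dvd w" by (simp add: coprime_dvd_mult_right_iff)
  then obtain w' where w': "w = p * w'" by (rule dvdE)
  have "u = q ^ e * w'" using w(1) p(1) unfolding w' by (simp add: prime_gt_0_nat)
  moreover have "e \<noteq> 0"
  proof
    assume "e = 0"
    then have "q dvd w" using w(1) \<open>q dvd u\<close> by (metis dvd_mult2 mult_1 power_0)
    then show False using w(2) q by (metis coprime_absorb_left not_prime_unit)
  qed
  ultimately have "u = q ^ Suc (e - 1) * w'" by simp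
  moreover have "p dvd q ^ j + 1" "w' dvd q ^ j + 1"
    using w(4) unfolding w' using dvd_mult_left dvd_mult_right by blast+
  ultimately show ?thesis using that w(3) by blast
qed

section \<open>Norms and autocorrelation\<close>

lemma sum_shift_periodic:
  fixes g :: "nat \<Rightarrow> complex"
  assumes "\<And>i. g (i + N) = g i"
  shows "(\<Sum>t<N. g (i + t)) = (\<Sum>t<N. g t)"
proof (induction i)
  case 0
  then show ?case by simp
next
  case (Suc i)
  have "(\<Sum>t<N. g (Suc i + t)) + g i = (\<Sum>t<Suc N. g (i + t))"
    unfolding sum.lessThan_Suc_shift by (simp add: add.commute)
  also have "\<dots> = (\<Sum>t<N. g (i + t)) + g i" using assms[of i] by simp
  finally show ?case using Suc.IH by simp
qed

text \<open>The squared absolute value of a discrete Fourier transform is the transform of the autocorrelation.\<close>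

lemma norm_fourier_transform:
  assumes per: "\<And>i. a (i + N) = a i" and x: "x ^ N = 1" "N > 0"
  shows "(\<Sum>i<N. a i * x ^ i) * cnj (\<Sum>i<N. a i * x ^ i)
       = (\<Sum>t<N. autocorrelation N a t * cnj x ^ t)"
proof -
  define g where "g i = cnj (a i * x ^ i)" for i
  have g_per: "g (i + N) = g i" for i by (simp add: g_def per power_add x)
  have cx: "x ^ i * cnj (x ^ i) = 1" for i
  proof -
    have "norm x = 1" using power_eq_1_iff[of x N] x by simp
    then show ?thesis
      by (simp only: complex_norm_square[symmetric] norm_power) simp
  qed
  have "(\<Sum>t<N. autocorrelation N a t * cnj x ^ t)
      = (\<Sum>t<N. \<Sum>i<N. a i * cnj (a (i + t)) * cnj x ^ t)"
    by (simp add: autocorrelation_def sum_distrib_right)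
  also have "\<dots> = (\<Sum>i<N. \<Sum>t<N. a i * cnj (a (i + t)) * cnj x ^ t)"
    by (rule sum.swap)
  also have "\<dots> = (\<Sum>i<N. a i * x ^ i * (\<Sum>t<N. g (i + t)))"
    unfolding sum_distrib_left
  proof (intro sum.cong refl)
    fix i t
    have "a i * x ^ i * g (i + t) = a i * cnj (a (i + t)) * cnj x ^ t * (x ^ i * cnj (x ^ i))"
      by (simp add: g_def power_add)
    then show "a i * cnj (a (i + t)) * cnj x ^ t = a i * x ^ i * g (i + t)"
      unfolding cx mult_1_right by (rule sym)
  qed
  also have "\<dots> = (\<Sum>i<N. a i * x ^ i * (\<Sum>t<N. g t))"
    unfolding sum_shift_periodic[of g, OF g_per] ..
  also have "\<dots> = (\<Sum>i<N. a i * x ^ i) * cnj (\<Sum>i<N. a i * x ^ i)"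
    unfolding g_def cnj_sum sum_distrib_right[symmetric] ..
  finally show ?thesis by (rule sym)
qed

section \<open>Counting exponents in residue classes\<close>

text \<open>
  The divisibility of the values passes to the coefficients modulo \<open>X\<^sup>u - 1\<close>, which are elements of the ring
  generated by \<open>\<zeta>\<close>.  In that ring the coordinates \<open>c j k\<close> with respect to the powers of \<open>\<zeta>\<close> are determined up to a
  common summand, so their differences over \<open>k\<close> are divisible by \<open>Q\<close>; if all of them vanished, \<open>G\<close> would
  vanish at every \<open>u\<close>-th root of unity.
\<close>

lemma ex_large_count_difference:
  assumes p: "prime p" and \<zeta>: "\<zeta> ^ p = 1" "\<zeta> \<noteq> 1" and u: "u > 0"
    and dvd: "\<And>x. x ^ u = 1 \<Longrightarrow> ev2 \<zeta> G x = of_nat Q * ev2 \<zeta> F x"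
    and nz: "x0 ^ u = 1" "ev2 \<zeta> G x0 \<noteq> 0"
  defines "c \<equiv> \<lambda>j k. fold_coeff p (fold_coeff u G j) k"
  shows "\<exists>j k l. int Q \<le> \<bar>c j k - c j l\<bar>"
proof -
  have p0: "p > 0" using p prime_gt_0_nat by blast
  define f where "f = (\<lambda>j k. fold_coeff p (fold_coeff u F j) k)"
  define P where "P = G - smult [:int Q:] F"
  have cP: "fold_coeff p (fold_coeff u P j) k = c j k - int Q * f j k" for j k
    by (simp add: P_def c_def f_def fold_coeff_diff fold_coeff_smult)
  have van: "(\<Sum>j<u. ev1 (fold_coeff u P j) \<zeta> * x ^ j) = 0" if "x ^ u = 1" for x
    unfolding ev1_hom.eval_fold[OF that u, symmetric]
    using dvd[OF that] by (simp add: P_def ev2_simps)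
  have eq: "c j k - int Q * f j k = c j l - int Q * f j l"
    if "j < u" "k < p" "l < p" for j k l
  proof -
    have "ev1 (fold_coeff u P j) \<zeta> = 0"
      using vanishing_on_roots_of_unity[OF u van that(1)] .
    then have "(\<Sum>k<p. of_int (c j k - int Q * f j k) * \<zeta> ^ k) = 0"
      unfolding int_hom.eval_fold[OF \<zeta>(1) p0] cP .
    from prime_root_of_unity_relation[OF p \<zeta> this that(2,3)] show ?thesis .
  qed
  have "\<exists>j<u. \<exists>k<p. c j k \<noteq> c j 0"
  proof (rule ccontr)
    assume "\<not> ?thesis"
    then have const: "c j k = c j 0" if "j < u" "k < p" for j k using that by blast
    have "ev1 (fold_coeff u G j) \<zeta> = 0" if "j < u" for j
    proof -
      have "ev1 (fold_coeff u G j) \<zeta> = (\<Sum>k<p. of_int (c j k) * \<zeta> ^ k)"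
        unfolding c_def by (rule int_hom.eval_fold[OF \<zeta>(1) p0])
      also have "\<dots> = (\<Sum>k<p. of_int (c j 0) * \<zeta> ^ k)"
      proof (rule sum.cong)
        fix k assume "k \<in> {..<p}"
        then have "c j k = c j 0" by (intro const that) simp
        then show "of_int (c j k) * \<zeta> ^ k = of_int (c j 0) * \<zeta> ^ k" by (simp only:)
      qed simp
      also have "\<dots> = 0"
        using sum_powers_root_of_unity[OF \<zeta>] by (simp flip: sum_distrib_left)
      finally show ?thesis .
    qed
    then have "ev2 \<zeta> G x0 = 0"
      unfolding ev1_hom.eval_fold[OF nz(1) u] by simp
    then show False using nz(2) by simp
  qed
  then obtain j k where jk: "j < u" "k < p" "c j k \<noteq> c j 0" by blast
  have "c j k - c j 0 = int Q * (f j k - f j 0)"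
    using eq[OF jk(1,2) p0] by (simp add: algebra_simps)
  then have "int Q dvd c j k - c j 0" by simp
  then have "int Q \<le> \<bar>c j k - c j 0\<bar>"
    using dvd_imp_le_int[of "c j k - c j 0" "int Q"] jk(3) by simp
  then show ?thesis by blast
qed

lemma fold_coeff_exponent_sum:
  assumes "finite I"
  shows "fold_coeff p (fold_coeff u (\<Sum>i\<in>I. monom (monom 1 (\<kappa> i)) (e i)) j) k
       = int (card {i \<in> I. e i mod u = j \<and> \<kappa> i mod p = k})"
proof -
  have "fold_coeff p (fold_coeff u (\<Sum>i\<in>I. monom (monom 1 (\<kappa> i)) (e i)) j) k
      = (\<Sum>i\<in>I. if e i mod u = j \<and> \<kappa> i mod p = k then 1 else (0::int))"
    unfolding fold_coeff_sum fold_coeff_monom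
    by (rule sum.cong) (auto simp: fold_coeff_monom)
  also have "\<dots> = int (card {i \<in> I. e i mod u = j \<and> \<kappa> i mod p = k})"
    using assms by (simp add: sum.If_cases Int_def)
  finally show ?thesis .
qed

lemma card_residue_class_le:
  assumes "u > 0" "u dvd N"
  shows "card {i \<in> {..<N}. (i + s) mod u = j} \<le> N div u"
proof -
  obtain m where m: "N = u * m" using assms(2) by (rule dvdE)
  let ?S = "{i \<in> {..<N}. (i + s) mod u = j}"
  have "inj_on (\<lambda>i. i div u) ?S"
  proof (rule inj_onI)
    fix a b assume "a \<in> ?S" "b \<in> ?S" and d: "a div u = b div u"
    then have "[a + s = b + s] (mod u)" by (simp add: cong_def)
    then have "a mod u = b mod u" by (simp only: cong_add_rcancel_nat) (simp only: cong_def)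
    then show "a = b" using d by (metis div_mult_mod_eq)
  qed
  moreover have "(\<lambda>i. i div u) ` ?S \<subseteq> {..<m}"
    using m assms(1) by (auto simp: less_mult_imp_div_less mult.commute)
  ultimately have "card ?S \<le> card {..<m}" by (rule card_inj_on_le) simp
  then show ?thesis using m assms(1) by simp
qed

section \<open>Almost p-ary nearly perfect sequences\<close>

locale nearly_perfect_sequence =
  fixes p n :: nat and \<gamma> :: int and a :: "nat \<Rightarrow> complex" and \<zeta> :: complex and \<kappa> :: "nat \<Rightarrow> nat"
  assumes p: "prime p" and n: "n \<ge> 1" and \<gamma>: "\<bar>\<gamma>\<bar> < int n"
    and per: "\<And>i. a (i + (n + 1)) = a i" and a0: "a 0 = 0"
    and \<zeta>: "\<zeta> ^ p = 1" "\<zeta> \<noteq> 1"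
    and a_eq: "\<And>i. i \<in> {1..<n+1} \<Longrightarrow> a i = \<zeta> ^ \<kappa> i"
    and nps: "nearly_perfect (n + 1) a \<gamma>"
begin

definition seq_poly :: "int poly poly" where
  "seq_poly = (\<Sum>i\<in>{1..<n+1}. monom (monom 1 (\<kappa> i)) i)"

lemma ev2_seq_poly: "ev2 \<zeta> seq_poly x = (\<Sum>i<n+1. a i * x ^ i)"
proof -
  have "ev2 \<zeta> seq_poly x = (\<Sum>i\<in>{1..<n+1}. a i * x ^ i)"
    unfolding seq_poly_def ev2_simps by (rule sum.cong) (simp_all add: a_eq ev1_simps)
  also have "\<dots> = (\<Sum>i<n+1. a i * x ^ i)"
    by (rule sum.mono_neutral_left) (auto simp: a0 Suc_le_eq)
  finally show ?thesis .
qed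

lemma p0: "p > 0" using p prime_gt_0_nat by blast

lemma autocorrelation_0: "autocorrelation (n + 1) a 0 = of_nat n"
proof -
  have "norm \<zeta> = 1" using power_eq_1_iff[of \<zeta> p] \<zeta> p0 by simp
  have "autocorrelation (n + 1) a 0 = (\<Sum>i\<in>{1..<n+1}. a i * cnj (a i))"
    unfolding autocorrelation_def
    by (rule sum.mono_neutral_cong_right) (auto simp: a0 Suc_le_eq)
  also have "\<dots> = (\<Sum>i\<in>{1..<n+1}. 1)"
  proof (rule sum.cong)
    fix i assume "i \<in> {1..<n+1}"
    then have "norm (a i) = 1" using a_eq \<open>norm \<zeta> = 1\<close> by (simp add: norm_power)
    then show "a i * cnj (a i) = 1" by (simp flip: complex_norm_square)
  qed simp
  finally show ?thesis by simp
qed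

lemma norm_character:
  assumes x: "x ^ (n + 1) = 1"
  shows "ev2 \<zeta> seq_poly x * cnj (ev2 \<zeta> seq_poly x) = of_int (if x = 1 then (\<gamma> + 1) * int n else int n - \<gamma>)"
proof -
  have "ev2 \<zeta> seq_poly x * cnj (ev2 \<zeta> seq_poly x) = (\<Sum>t<n+1. autocorrelation (n + 1) a t * cnj x ^ t)"
    unfolding ev2_seq_poly by (rule norm_fourier_transform[of a "n + 1" x, OF per x]) simp
  also have "\<dots> = (\<Sum>t<n+1. of_int \<gamma> * cnj x ^ t + (if t = 0 then of_int (int n - \<gamma>) else 0))"
    by (rule sum.cong) (use nps autocorrelation_0 in \<open>auto simp: nearly_perfect_def\<close>)
  also have "\<dots> = of_int \<gamma> * (\<Sum>t<n+1. cnj x ^ t) + of_int (int n - \<gamma>)"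
    unfolding sum.distrib sum_distrib_left[symmetric] by (subst sum.delta) auto
  also have "(\<Sum>t<n+1. cnj x ^ t) = (if x = 1 then of_nat (n + 1) else 0)"
  proof (cases "x = 1")
    case False
    have "cnj x ^ (n + 1) = 1" using x by (metis complex_cnj_one complex_cnj_power)
    moreover have "cnj x \<noteq> 1" using False by (metis complex_cnj_cnj complex_cnj_one)
    ultimately show ?thesis using sum_powers_root_of_unity[of "cnj x" "n + 1"] False by simp
  qed simp
  also have "of_int \<gamma> * (if x = 1 then of_nat (n + 1) else 0) + of_int (int n - \<gamma>)
      = (of_int (if x = 1 then (\<gamma> + 1) * int n else int n - \<gamma>) :: complex)"
    by (simp add: algebra_simps)
  finally show ?thesis .
qed

lemma root_of_divisor: "x ^ u = 1 \<Longrightarrow> u dvd n + 1 \<Longrightarrow> x ^ (n + 1) = 1" for x :: complex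
  by (metis dvdE power_mult power_one)

text \<open>
  The parity statements come from a single value of the character sum: the trivial character has norm
  \<open>(\<gamma> + 1) n\<close>, every other one has norm \<open>n - \<gamma>\<close>.
\<close>

lemma even_trivial_character:
  assumes q: "prime q" "q \<noteq> p" "\<not> q dvd u" "self_conjugate q (u * p)"
    and r: "exactly_divides q r ((\<gamma> + 1) * int n)"
  shows "even r"
proof -
  obtain j where j: "j > 0" "p dvd q ^ j + 1" "u dvd q ^ j + 1"
    using self_conjugate_exponent_unramified[OF q(1) p q(2,4,3)] .
  show ?thesis
    by (rule even_exact_power[OF \<zeta>(1) p0 _ _ q(1) j(2) _ j(1) _ r, of 1 1 seq_poly])
      (use norm_character[of 1] in simp_all)
qed

lemma even_nontrivial_character:
  assumes q: "prime q" "q \<noteq> p" "\<not> q dvd u" "self_conjugate q (u * p)"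
    and u: "u > 1" "u dvd n + 1" and r: "exactly_divides q r (int n - \<gamma>)"
  shows "even r"
proof -
  obtain j where j: "j > 0" "p dvd q ^ j + 1" "u dvd q ^ j + 1"
    using self_conjugate_exponent_unramified[OF q(1) p q(2,4,3)] .
  obtain x :: complex where x: "x ^ u = 1" "x ^ 1 \<noteq> 1"
    using ex_root_of_unity_not_root[of 1 u] u by auto
  show ?thesis
    by (rule even_exact_power[OF \<zeta>(1) p0 x(1) _ q(1) j(2,3,1) _ r, of seq_poly])
      (use norm_character[OF root_of_divisor[OF x(1) u(2)]] x u in simp_all)
qed

text \<open>The shift \<open>s\<close> of the exponents serves for the polynomial multiplied by \<open>X\<^sup>s\<close>.\<close>

lemma count_bounds:
  assumes "u > 0" "u dvd n + 1"
  defines "c \<equiv> \<lambda>s j k. fold_coeff p (fold_coeff u (\<Sum>i\<in>{1..<n+1}. monom (monom 1 (\<kappa> i)) (i + s)) j) k"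
  shows "0 \<le> c s j k" "c s j k \<le> int ((n + 1) div u)"
proof -
  have c: "c s j k = int (card {i \<in> {1..<n+1}. (i + s) mod u = j \<and> \<kappa> i mod p = k})"
    unfolding c_def by (rule fold_coeff_exponent_sum) simp
  then show "0 \<le> c s j k" by simp
  have "card {i \<in> {1..<n+1}. (i + s) mod u = j \<and> \<kappa> i mod p = k}
      \<le> card {i \<in> {..<n+1}. (i + s) mod u = j}"
    by (rule card_mono) auto
  also have "\<dots> \<le> (n + 1) div u" by (rule card_residue_class_le) fact+
  finally show "c s j k \<le> int ((n + 1) div u)" using c by simp
qed

lemma divisor_bound:
  assumes u: "u > 0" "u dvd n + 1"
    and dvd: "\<And>x. x ^ u = 1 \<Longrightarrow> ev2 \<zeta> seq_poly x = of_nat Q * ev2 \<zeta> F x"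
    and nz: "x0 ^ u = 1" "ev2 \<zeta> seq_poly x0 \<noteq> 0"
  shows "Q \<le> (n + 1) div u"
proof -
  let ?c = "\<lambda>j k. fold_coeff p (fold_coeff u seq_poly j) k"
  obtain j k l where "int Q \<le> \<bar>?c j k - ?c j l\<bar>"
    using ex_large_count_difference[OF p \<zeta> u(1) dvd nz] by blast
  moreover have "0 \<le> ?c j k \<and> ?c j k \<le> int ((n + 1) div u)" for k
    using count_bounds[OF u, of 0 j k] by (simp add: seq_poly_def)
  from this[of k] this[of l] have "\<bar>?c j k - ?c j l\<bar> \<le> int ((n + 1) div u)" by linarith
  ultimately show ?thesis by linarith
qed

text \<open>
  At the roots with \<open>x\<^sup>s = 1\<close> nothing is known about the polynomial of the sequence; the factor
  \<open>1 - X\<^sup>s\<close> vanishes there and makes the divisibility hold at all \<open>u\<close>-th roots of unity.  The counts are then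
  differences of two numbers between \<open>0\<close> and \<open>(n + 1) / u\<close>.
\<close>

lemma divisor_bound_ramified:
  assumes u: "u > 0" "u dvd n + 1"
    and dvd: "\<And>x. x ^ u = 1 \<Longrightarrow> x ^ s \<noteq> 1 \<Longrightarrow> ev2 \<zeta> seq_poly x = of_nat Q * ev2 \<zeta> F x"
    and nz: "x0 ^ u = 1" "x0 ^ s \<noteq> 1" "ev2 \<zeta> seq_poly x0 \<noteq> 0"
  shows "Q \<le> 2 * ((n + 1) div u)"
proof -
  define X where "X = (monom 1 s :: int poly poly)"
  define B where "B = (\<Sum>i\<in>{1..<n+1}. monom (monom (1::int) (\<kappa> i)) (i + s))"
  have "X * seq_poly = B"
    unfolding seq_poly_def B_def X_def sum_distrib_left
    by (rule sum.cong) (simp_all add: mult_monom add.commute)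
  then have B: "seq_poly - B = (1 - X) * seq_poly" by (simp add: left_diff_distrib)
  have evX: "ev2 \<zeta> X x = x ^ s" for x by (simp add: X_def ev2_simps)
  let ?c = "\<lambda>G j k. fold_coeff p (fold_coeff u G j) k"
  have "\<exists>j k l. int Q \<le> \<bar>?c (seq_poly - B) j k - ?c (seq_poly - B) j l\<bar>"
  proof (rule ex_large_count_difference[OF p \<zeta> u(1)])
    fix x :: complex assume x: "x ^ u = 1"
    show "ev2 \<zeta> (seq_poly - B) x = of_nat Q * ev2 \<zeta> ((1 - X) * F) x"
      unfolding B using dvd[OF x] by (cases "x ^ s = 1") (simp_all add: ev2_simps evX)
  next
    show "x0 ^ u = 1" by fact
    show "ev2 \<zeta> (seq_poly - B) x0 \<noteq> 0" unfolding B using nz by (simp add: ev2_simps evX)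
  qed
  then obtain j k l where Q: "int Q \<le> \<bar>?c (seq_poly - B) j k - ?c (seq_poly - B) j l\<bar>" by blast
  have c: "?c (seq_poly - B) j k = ?c seq_poly j k - ?c B j k" for k by (simp add: fold_coeff_diff)
  have bA: "0 \<le> ?c seq_poly j k \<and> ?c seq_poly j k \<le> int ((n + 1) div u)" for k
    using count_bounds[OF u, of 0 j k] by (simp add: seq_poly_def)
  have bB: "0 \<le> ?c B j k \<and> ?c B j k \<le> int ((n + 1) div u)" for k
    using count_bounds[OF u, of s j k] by (simp add: B_def)
  have "\<bar>?c (seq_poly - B) j k - ?c (seq_poly - B) j l\<bar> \<le> 2 * int ((n + 1) div u)"
    unfolding c using bA[of k] bA[of l] bB[of k] bB[of l] by linarith
  then show ?thesis using Q by linarith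
qed

lemma unramified_bound:
  assumes q: "prime q" "q \<noteq> p" "\<not> q dvd u" "self_conjugate q (u * p)"
    and u: "u > 0" "u dvd n + 1"
    and C: "\<And>x. x ^ u = 1 \<Longrightarrow> ev2 \<zeta> seq_poly x * cnj (ev2 \<zeta> seq_poly x) = of_nat q ^ r * ev2 \<zeta> C x"
    and nz: "x0 ^ u = 1" "ev2 \<zeta> seq_poly x0 \<noteq> 0"
  shows "q ^ ((r + 1) div 2) \<le> (n + 1) div u"
proof -
  obtain j where j: "j > 0" "p dvd q ^ j + 1" "u dvd q ^ j + 1"
    using self_conjugate_exponent_unramified[OF q(1) p q(2,4,3)] .
  interpret value_ring p u \<zeta> "{x. x ^ u = 1}"
    by unfold_locales (use p0 u \<zeta> in auto)
  have "vdvd (\<lambda>x. of_nat q ^ r) (\<lambda>x. ev2 \<zeta> seq_poly x * cnj (ev2 \<zeta> seq_poly x))"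
    by (rule vdvd_I[OF VR_ev2[of C]]) (simp add: C)
  from unramified_divisibility[OF q(1) j(2,3,1) VR_ev2 this]
  obtain h where h: "h \<in> VR" "\<And>x. x ^ u = 1 \<Longrightarrow> ev2 \<zeta> seq_poly x = of_nat q ^ ((r + 1) div 2) * h x"
    unfolding vdvd_def by blast
  from h(1) obtain F where F: "\<And>x. x ^ u = 1 \<Longrightarrow> h x = ev2 \<zeta> F x"
    unfolding VR_def by blast
  show ?thesis
    by (rule divisor_bound[OF u _ nz, of _ F]) (simp add: h(2) F)
qed

lemma ramified_bound:
  assumes q: "prime q" "q \<noteq> p" "q dvd u" "self_conjugate q (u * p)"
    and u: "u > 0" "u dvd n + 1" and r: "int q ^ r dvd int n - \<gamma>"
  shows "q ^ (r div 2) \<le> 2 * ((n + 1) div u)"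
proof -
  obtain j k w where j: "j > 0" "p dvd q ^ j + 1" "w dvd q ^ j + 1" and w: "u = q ^ Suc k * w"
    using self_conjugate_exponent_ramified[OF q(1) p q(2,4,3)] .
  let ?s = "q ^ k * w"
  interpret value_ring p u \<zeta> "{x. x ^ u = 1 \<and> x ^ ?s \<noteq> 1}"
    by unfold_locales (use p0 u \<zeta> in auto)
  obtain M where M: "int n - \<gamma> = int q ^ r * M" using r by (rule dvdE)
  have norm: "ev2 \<zeta> seq_poly x * cnj (ev2 \<zeta> seq_poly x) = of_int (int n - \<gamma>)"
    if "x ^ u = 1" "x ^ ?s \<noteq> 1" for x
  proof -
    have "x \<noteq> 1" using that(2) by auto
    then show ?thesis using norm_character[OF root_of_divisor[OF that(1) u(2)]] by simp
  qed
  have "vdvd (\<lambda>x. of_nat q ^ r) (\<lambda>x. ev2 \<zeta> seq_poly x * cnj (ev2 \<zeta> seq_poly x))"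
    by (rule vdvd_I[OF VR_of_int[of M]]) (simp add: norm M)
  from ramified_divisibility[OF q(1) j(2,1) w j(3) _ VR_ev2 this]
  obtain h where h: "h \<in> VR"
    "\<And>x. x ^ u = 1 \<Longrightarrow> x ^ ?s \<noteq> 1 \<Longrightarrow> ev2 \<zeta> seq_poly x = of_nat q ^ (r div 2) * h x"
    unfolding vdvd_def by blast
  from h(1) obtain F where F: "\<And>x. x ^ u = 1 \<Longrightarrow> x ^ ?s \<noteq> 1 \<Longrightarrow> h x = ev2 \<zeta> F x"
    unfolding VR_def by blast
  have "0 < ?s" "?s < u" using w u(1) prime_gt_1_nat[OF q(1)] by (auto intro!: Nat.gr0I)
  then obtain x0 :: complex where x0: "x0 ^ u = 1" "x0 ^ ?s \<noteq> 1"
    using ex_root_of_unity_not_root by blast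
  have "int n - \<gamma> \<noteq> 0" using \<gamma> by linarith
  then have "(of_int (int n - \<gamma>) :: complex) \<noteq> 0" by (simp only: of_int_eq_0_iff not_False_eq_True)
  then have "ev2 \<zeta> seq_poly x0 \<noteq> 0" using norm[OF x0] by auto
  then show ?thesis
    by (intro divisor_bound_ramified[OF u _ x0, of _ F]) (simp_all add: h(2) F)
qed

lemma bound_type_0:
  assumes "\<gamma> = 0" and q: "prime q" "q \<noteq> p" "self_conjugate q (u * p)" "\<not> q dvd u"
    and u: "u > 0" "u dvd n + 1" and r: "q ^ r dvd n"
  shows "q ^ ((r + 1) div 2) \<le> (n + 1) div u"
proof -
  obtain m where m: "n = q ^ r * m" using r by (rule dvdE)
  have norm: "ev2 \<zeta> seq_poly x * cnj (ev2 \<zeta> seq_poly x) = of_nat n" if "x ^ u = 1" for x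
    using norm_character[OF root_of_divisor[OF that u(2)]] \<open>\<gamma> = 0\<close> by simp
  have C: "ev2 \<zeta> seq_poly x * cnj (ev2 \<zeta> seq_poly x) = of_nat q ^ r * ev2 \<zeta> (of_nat m) x"
    if "x ^ u = 1" for x
    unfolding norm[OF that] by (subst m) (simp add: ev2_simps)
  have "ev2 \<zeta> seq_poly 1 \<noteq> 0" using norm[of 1] n by auto
  then show ?thesis
    by (intro unramified_bound[OF q(1,2,4,3) u C, of 1]) simp_all
qed

text \<open>
  The norms are \<open>0\<close> at \<open>x = 1\<close> and \<open>n + 1\<close> at the other roots.  They have to be written as
  \<open>q\<^sup>r\<close> times one polynomial in \<open>x\<close>: with \<open>n + 1 = q\<^sup>r u m\<close> it is \<open>m (u - (1 + x + ... + x\<^sup>u\<^sup>-\<^sup>1))\<close>.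
\<close>

lemma bound_type_minus_1:
  assumes "\<gamma> = -1" and q: "prime q" "q \<noteq> p" "self_conjugate q (u * p)" "\<not> q dvd u"
    and u: "u > 1" "u dvd n + 1" and r: "q ^ r dvd n + 1"
  shows "q ^ ((r + 1) div 2) \<le> (n + 1) div u"
proof -
  have "coprime (q ^ r) u" using q by (simp add: prime_imp_coprime)
  then have "q ^ r * u dvd n + 1" using r u(2) by (rule divides_mult[rotated 2])
  then obtain m where m: "n + 1 = q ^ r * u * m" by (rule dvdE)
  let ?C = "of_nat (u * m) - of_nat m * (\<Sum>i<u. monom 1 i)"
  have norm: "ev2 \<zeta> seq_poly x * cnj (ev2 \<zeta> seq_poly x) = (if x = 1 then 0 else of_nat (n + 1))" if "x ^ u = 1" for x
    using norm_character[OF root_of_divisor[OF that u(2)]] \<open>\<gamma> = -1\<close> by simp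
  have C: "ev2 \<zeta> seq_poly x * cnj (ev2 \<zeta> seq_poly x) = of_nat q ^ r * ev2 \<zeta> ?C x" if "x ^ u = 1" for x
    unfolding norm[OF that] m
    using sum_powers_root_of_unity[OF that] by (simp add: ev2_simps)
  obtain x :: complex where x: "x ^ u = 1" "x ^ 1 \<noteq> 1"
    using ex_root_of_unity_not_root[of 1 u] u by auto
  have "ev2 \<zeta> seq_poly x \<noteq> 0"
  proof
    assume "ev2 \<zeta> seq_poly x = 0"
    then have "(of_nat (n + 1) :: complex) = 0" using norm[OF x(1)] x(2) by simp
    then show False by (simp only: of_nat_eq_0_iff)
  qed
  with u(1) show ?thesis
    by (intro unramified_bound[OF q(1,2,4,3) _ u(2) C x(1)]) simp_all
qed

end

theorem theorem4:
  fixes p n :: nat and \<gamma> :: int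
  assumes "prime p" and "n \<ge> 1" and "\<bar>\<gamma>\<bar> < int n"
    and "\<exists>a. almost_p_ary p (n + 1) a \<and> nearly_perfect (n + 1) a \<gamma>"
  shows
    "(\<gamma> = 0 \<longrightarrow>
       (\<forall>q r u :: nat. prime q \<and> q \<noteq> p \<and> q dvd n \<and> exactly_divides q r (int n) \<and>
          u \<ge> 1 \<and> u dvd n + 1 \<and> self_conjugate q (u * p) \<longrightarrow>
          even r \<and> real (q ^ (r div 2)) \<le> real (n + 1) / real u))
   \<and> (\<gamma> = -1 \<longrightarrow>
       (\<forall>q r u :: nat. prime q \<and> q \<noteq> p \<and> int q dvd int n - \<gamma> \<and>
          exactly_divides q r (int n - \<gamma>) \<and>
          u > 1 \<and> u dvd n + 1 \<and> self_conjugate q (u * p) \<longrightarrow>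
          (\<not> q dvd u \<longrightarrow> even r \<and> real (q ^ (r div 2)) \<le> real (n + 1) / real u) \<and>
          (q dvd u \<longrightarrow> real (q ^ (r div 2)) \<le> 2 * (real (n + 1) / real u))))
   \<and> (\<gamma> \<noteq> 0 \<longrightarrow>
       (\<forall>q r u :: nat. prime q \<and> q \<noteq> p \<and>
          ((int q dvd (\<gamma> + 1) * int n \<and> exactly_divides q r ((\<gamma> + 1) * int n) \<and>
              u \<ge> 1 \<and> u dvd n + 1 \<and> self_conjugate q (u * p)) \<or>
           (int q dvd int n - \<gamma> \<and> exactly_divides q r (int n - \<gamma>) \<and>
              u > 1 \<and> u dvd n + 1 \<and> self_conjugate q (u * p))) \<longrightarrow>
          \<not> q dvd u \<longrightarrow> even r))"
proof -
  obtain a where a: "almost_p_ary p (n + 1) a" "nearly_perfect (n + 1) a \<gamma>"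
    using assms(4) by blast
  then obtain \<zeta> where \<zeta>: "primitive_root_of_unity p \<zeta>" "\<forall>i\<in>{1..<n+1}. \<exists>k. a i = \<zeta> ^ k"
    and per: "\<And>i. a (i + (n + 1)) = a i" and a0: "a 0 = 0"
    unfolding almost_p_ary_def by blast
  from \<zeta>(2) obtain \<kappa> where \<kappa>: "\<forall>i\<in>{1..<n+1}. a i = \<zeta> ^ \<kappa> i" by metis
  have z: "\<zeta> ^ p = 1" "\<zeta> \<noteq> 1"
    using \<zeta>(1) prime_gt_1_nat[OF assms(1)]
    unfolding primitive_root_of_unity_def by (auto dest: spec[of _ 1])
  interpret nearly_perfect_sequence p n \<gamma> a \<zeta> \<kappa>
    by unfold_locales (use assms z a per a0 \<kappa> in auto)
  have quot: "real ((n + 1) div u) = real (n + 1) / real u" if "u dvd n + 1" for u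
    using that by (rule real_of_nat_div)
  have half: "(r + 1) div 2 = r div 2" if "even r" for r :: nat using that by simp
  have bound: "real Q \<le> real (n + 1) / real u" if "Q \<le> (n + 1) div u" "u dvd n + 1" for Q u
    unfolding quot[OF that(2), symmetric] using that(1) by (simp only: of_nat_le_iff)
  show ?thesis
  proof (intro conjI impI allI)
    fix q r u :: nat
    assume "\<gamma> = 0" and h: "prime q \<and> q \<noteq> p \<and> q dvd n \<and> exactly_divides q r (int n) \<and>
      u \<ge> 1 \<and> u dvd n + 1 \<and> self_conjugate q (u * p)"
    have "\<not> q dvd u"
    proof
      assume "q dvd u"
      then have "q dvd n + 1" using h dvd_trans by blast
      then have "q dvd 1" using h dvd_add_right_iff[of q n 1] by simp
      then show False using h not_prime_unit by blast
    qed
    show "even r"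
      using even_trivial_character[of q u r] \<open>\<gamma> = 0\<close> h \<open>\<not> q dvd u\<close> by simp
    have "int (q ^ r) dvd int n" using h by (simp add: exactly_divides_def)
    then have "q ^ r dvd n" by (simp only: int_dvd_int_iff)
    then have "q ^ (r div 2) \<le> (n + 1) div u"
      using bound_type_0[of q u r] \<open>\<gamma> = 0\<close> h \<open>\<not> q dvd u\<close> half[OF \<open>even r\<close>] by simp
    then show "real (q ^ (r div 2)) \<le> real (n + 1) / real u" using h by (intro bound) auto
  next
    fix q r u :: nat
    assume "\<gamma> = -1" and h: "prime q \<and> q \<noteq> p \<and> int q dvd int n - \<gamma> \<and>
      exactly_divides q r (int n - \<gamma>) \<and> u > 1 \<and> u dvd n + 1 \<and> self_conjugate q (u * p)"
      and "\<not> q dvd u"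
    show "even r"
      using even_nontrivial_character[of q u r] h \<open>\<not> q dvd u\<close> by simp
    have "int (q ^ r) dvd int (n + 1)" using h \<open>\<gamma> = -1\<close> by (simp add: exactly_divides_def add.commute)
    then have "q ^ r dvd n + 1" by (simp only: int_dvd_int_iff)
    then have "q ^ (r div 2) \<le> (n + 1) div u"
      using bound_type_minus_1[of q u r] \<open>\<gamma> = -1\<close> h \<open>\<not> q dvd u\<close> half[OF \<open>even r\<close>] by simp
    then show "real (q ^ (r div 2)) \<le> real (n + 1) / real u" using h by (intro bound) auto
  next
    fix q r u :: nat
    assume "\<gamma> = -1" and h: "prime q \<and> q \<noteq> p \<and> int q dvd int n - \<gamma> \<and>
      exactly_divides q r (int n - \<gamma>) \<and> u > 1 \<and> u dvd n + 1 \<and> self_conjugate q (u * p)"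
      and "q dvd u"
    have "q ^ (r div 2) \<le> 2 * ((n + 1) div u)"
      using ramified_bound[of q u r] h \<open>q dvd u\<close> by (simp add: exactly_divides_def)
    then have "real (q ^ (r div 2)) \<le> real (2 * ((n + 1) div u))" by (simp only: of_nat_le_iff)
    also have "\<dots> = 2 * (real (n + 1) / real u)" using quot[of u] h by simp
    finally show "real (q ^ (r div 2)) \<le> 2 * (real (n + 1) / real u)" .
  next
    fix q r u :: nat
    assume "prime q \<and> q \<noteq> p \<and>
          ((int q dvd (\<gamma> + 1) * int n \<and> exactly_divides q r ((\<gamma> + 1) * int n) \<and>
              u \<ge> 1 \<and> u dvd n + 1 \<and> self_conjugate q (u * p)) \<or>
           (int q dvd int n - \<gamma> \<and> exactly_divides q r (int n - \<gamma>) \<and>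
              u > 1 \<and> u dvd n + 1 \<and> self_conjugate q (u * p)))" "\<not> q dvd u"
    then show "even r"
      using even_trivial_character[of q u r] even_nontrivial_character[of q u r] by blast
  qed
qed

end
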